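(* There exist asymptotically flat spacelike hypersurfaces in the Minkowski spacetime $\mathbb R^{3,1}$ with zero ADM energy-momentum ($E=0$ and $P=0$), but whose Beig–Ó Murchadha–Regge–Teitelboim (BORT) center of mass $C=(C^1,C^2,C^3)$ is finite and non-zero.
   Context: Minkowski spacetime is $\mathbb R^{3,1}$ with metric $-dt^2+\sum_i(dx^i)^2$. A spacelike slice is written as a graph $t=f(x^1,x^2,x^3)$, and $(x^1,x^2,x^3)$ restricted to the graph is used as the asymptotically flat coordinate system. The hypersurface carries the induced metric $g$ and second fundamental form $k$ (for a graph, $g_{ij}=\delta_{ij}-f_if_j$, $k_{ij}=\frac{1}{\sqrt{1-|\bar\nabla f|^2}}\bar\nabla_i\bar\nabla_jf$ with $\bar\nabla$ the flat connection), and $\pi=k-(\mathrm{tr}_gk)g$. Asymptotically flat means: for some $q>\frac12$, $p>\frac32$, $\epsilon>0$, outside a compact set each end is diffeomorphic to the complement of a compact set in $\mathbb R^3$ with $g_{ij}-\delta_{ij}=O_2(r^{-q})$, $k_{ij}=O_1(r^{-p})$, and $\mu,|J|=O(r^{-3-\epsilon})$, where $\mu=\frac12(R_g-|k|_g^2+(\mathrm{tr}_gk)^2)$, $J=\mathrm{div}_g k-d(\mathrm{tr}_gk)$ (here both vanish). $O_l(r^a)$ means that derivatives of order $s\le l$ are $O(r^{a-s})$. Definitions (limits as $r\to\infty$ of integrals over $|x|=r$ with Euclidean area measure $d\sigma_0$): $E=\frac1{16\pi}\lim\int\sum_{j,k}(\partial_kg_{jk}-\partial_jg_{kk})\frac{x^j}{|x|}d\sigma_0$,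 $P_i=\frac1{8\pi}\lim\int\sum_k\pi_{ik}\frac{x^k}{|x|}d\sigma_0$, and $$C^i=\frac1{16\pi}\lim_{r\to\infty}\int_{|x|=r}\Big[x^i\sum_{j,k}\Big(\frac{\partial g_{jk}}{\partial x^k}-\frac{\partial g_{kk}}{\partial x^j}\Big)\frac{x^j}{|x|}-\sum_k\Big((g_{ki}-\delta_{ki})\frac{x^k}{|x|}-(g_{kk}-\delta_{kk})\frac{x^i}{|x|}\Big)\Big]d\sigma_0 .$$ (No division by $E$ is made.) *)

theory Defs
  imports "HOL-Analysis.Analysis" "HOL-Library.Landau_Symbols"
begin

section \<open>Calculus on Euclidean 3-space\<close>

definition partial_deriv ::
    "3 \<Rightarrow> (real^3 \<Rightarrow> 'a::real_normed_vector) \<Rightarrow> real^3 \<Rightarrow> 'a" where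
  "partial_deriv i F x = frechet_derivative F (at x) (axis i 1)"

definition iter_partial ::
    "3 list \<Rightarrow> (real^3 \<Rightarrow> 'a::real_normed_vector) \<Rightarrow> real^3 \<Rightarrow> 'a" where
  "iter_partial is F = foldr partial_deriv is F"

text \<open>Differentiability of every iterated partial derivative also makes each of them continuous,
  so this is the usual notion of a \<open>C\<^sup>\<infinity>\<close> function.\<close>

definition smooth :: "(real^3 \<Rightarrow> real) \<Rightarrow> bool" where
  "smooth F \<longleftrightarrow> (\<forall>is x. iter_partial is F differentiable (at x))"

text \<open>\<open>O_deriv l a h\<close> is \<open>h = O\<^sub>l(r\<^sup>a)\<close>. It does not itself require \<open>h\<close> to be differentiable;
  it is only applied to tensors built from a smooth graph function.\<close>

definition O_deriv :: "nat \<Rightarrow> real \<Rightarrow> (real^3 \<Rightarrow> real) \<Rightarrow> bool" where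
  "O_deriv l a h \<longleftrightarrow>
     (\<forall>is. length is \<le> l \<longrightarrow>
        iter_partial is h \<in> O[at_infinity](\<lambda>x. norm x powr (a - real (length is))))"

definition sphere_point :: "real \<Rightarrow> real \<Rightarrow> real \<Rightarrow> real^3" where
  "sphere_point r \<theta> \<phi> = vector [r * sin \<theta> * cos \<phi>, r * sin \<theta> * sin \<phi>, r * cos \<theta>]"

text \<open>The integral over the sphere \<open>|x| = r\<close> with respect to the Euclidean area measure,
  whose element in spherical coordinates is \<open>r\<^sup>2 sin \<theta> d\<phi> d\<theta>\<close>.\<close>

definition sphere_integral :: "real \<Rightarrow> (real^3 \<Rightarrow> real) \<Rightarrow> real" where
  "sphere_integral r F =
     integral {0..pi} (\<lambda>\<theta>. integral {0..2 * pi} (\<lambda>\<phi>.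
       F (sphere_point r \<theta> \<phi>) * (r\<^sup>2 * sin \<theta>)))"


section \<open>Graphs in Minkowski spacetime\<close>

type_synonym spacetime = "real \<times> (real^3)"

type_synonym tensor_field = "real^3 \<Rightarrow> real^3^3"

definition minkowski :: "spacetime \<Rightarrow> spacetime \<Rightarrow> real" where
  "minkowski u v = - (fst u * fst v) + snd u \<bullet> snd v"

definition graph_map :: "(real^3 \<Rightarrow> real) \<Rightarrow> real^3 \<Rightarrow> spacetime" where
  "graph_map f x = (f x, x)"

definition gradient :: "(real^3 \<Rightarrow> real) \<Rightarrow> real^3 \<Rightarrow> real^3" where
  "gradient f x = (\<chi> i. partial_deriv i f x)"

definition induced_metric :: "(real^3 \<Rightarrow> real) \<Rightarrow> tensor_field" where
  "induced_metric f x =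
     (\<chi> i j. minkowski (partial_deriv i (graph_map f) x) (partial_deriv j (graph_map f) x))"

definition spacelike_graph :: "(real^3 \<Rightarrow> real) \<Rightarrow> bool" where
  "spacelike_graph f \<longleftrightarrow> (\<forall>x v. v \<noteq> 0 \<longrightarrow> v \<bullet> (induced_metric f x *v v) > 0)"

definition unit_normal :: "(real^3 \<Rightarrow> real) \<Rightarrow> real^3 \<Rightarrow> spacetime" where
  "unit_normal f x = (1 / sqrt (1 - (norm (gradient f x))\<^sup>2)) *\<^sub>R (1, gradient f x)"

text \<open>The minus sign makes this \<open>k(u,v) = \<langle>D\<^sub>u n, v\<rangle>\<close> for the future-directed unit normal \<open>n\<close>.\<close>

definition second_fundamental_form :: "(real^3 \<Rightarrow> real) \<Rightarrow> tensor_field" where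
  "second_fundamental_form f x =
     (\<chi> i j. - minkowski (partial_deriv i (partial_deriv j (graph_map f)) x) (unit_normal f x))"


section \<open>Riemannian quantities in a global chart\<close>

definition christoffel :: "tensor_field \<Rightarrow> 3 \<Rightarrow> 3 \<Rightarrow> 3 \<Rightarrow> real^3 \<Rightarrow> real" where
  "christoffel g l i j x =
     (1 / 2) * (\<Sum>m\<in>UNIV. matrix_inv (g x) $ l $ m *
        (partial_deriv i (\<lambda>y. g y $ m $ j) x + partial_deriv j (\<lambda>y. g y $ i $ m) x
         - partial_deriv m (\<lambda>y. g y $ i $ j) x))"

definition ricci :: "tensor_field \<Rightarrow> 3 \<Rightarrow> 3 \<Rightarrow> real^3 \<Rightarrow> real" where
  "ricci g i j x =
     (\<Sum>l\<in>UNIV. partial_deriv l (christoffel g l i j) x - partial_deriv j (christoffel g l i l) x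
        + (\<Sum>m\<in>UNIV. christoffel g l l m x * christoffel g m i j x
                     - christoffel g l j m x * christoffel g m i l x))"

definition metric_trace :: "tensor_field \<Rightarrow> tensor_field \<Rightarrow> real^3 \<Rightarrow> real" where
  "metric_trace g h x = (\<Sum>i\<in>UNIV. \<Sum>j\<in>UNIV. matrix_inv (g x) $ i $ j * h x $ i $ j)"

definition scalar_curvature :: "tensor_field \<Rightarrow> real^3 \<Rightarrow> real" where
  "scalar_curvature g x = metric_trace g (\<lambda>y. \<chi> i j. ricci g i j y) x"

definition tensor_norm_sq :: "tensor_field \<Rightarrow> tensor_field \<Rightarrow> real^3 \<Rightarrow> real" where
  "tensor_norm_sq g h x =
     (\<Sum>i\<in>UNIV. \<Sum>j\<in>UNIV. \<Sum>a\<in>UNIV. \<Sum>b\<in>UNIV.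
        matrix_inv (g x) $ i $ a * matrix_inv (g x) $ j $ b * h x $ i $ j * h x $ a $ b)"

definition covariant_deriv ::
    "tensor_field \<Rightarrow> tensor_field \<Rightarrow> 3 \<Rightarrow> 3 \<Rightarrow> 3 \<Rightarrow> real^3 \<Rightarrow> real" where
  "covariant_deriv g h l i j x =
     partial_deriv l (\<lambda>y. h y $ i $ j) x
     - (\<Sum>m\<in>UNIV. christoffel g m l i x * h x $ m $ j + christoffel g m l j x * h x $ i $ m)"

definition metric_div :: "tensor_field \<Rightarrow> tensor_field \<Rightarrow> 3 \<Rightarrow> real^3 \<Rightarrow> real" where
  "metric_div g h i x =
     (\<Sum>j\<in>UNIV. \<Sum>l\<in>UNIV. matrix_inv (g x) $ j $ l * covariant_deriv g h l i j x)"

definition covector_norm :: "tensor_field \<Rightarrow> (real^3 \<Rightarrow> real^3) \<Rightarrow> real^3 \<Rightarrow> real" where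
  "covector_norm g \<omega> x = sqrt (\<omega> x \<bullet> (matrix_inv (g x) *v \<omega> x))"


section \<open>Asymptotically flat initial data and its conserved quantities\<close>

definition energy_density :: "tensor_field \<Rightarrow> tensor_field \<Rightarrow> real^3 \<Rightarrow> real" where
  "energy_density g k x =
     (1 / 2) * (scalar_curvature g x - tensor_norm_sq g k x + (metric_trace g k x)\<^sup>2)"

definition momentum_density :: "tensor_field \<Rightarrow> tensor_field \<Rightarrow> real^3 \<Rightarrow> real^3" where
  "momentum_density g k x =
     (\<chi> i. metric_div g k i x - partial_deriv i (metric_trace g k) x)"

definition conjugate_momentum :: "tensor_field \<Rightarrow> tensor_field \<Rightarrow> tensor_field" where
  "conjugate_momentum g k x = k x - metric_trace g k x *\<^sub>R g x"

definition metric_deviation :: "tensor_field \<Rightarrow> tensor_field" where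
  "metric_deviation g x = g x - mat 1"

definition asymptotically_flat :: "tensor_field \<Rightarrow> tensor_field \<Rightarrow> bool" where
  "asymptotically_flat g k \<longleftrightarrow>
     (\<exists>q p \<epsilon> :: real. q > 1 / 2 \<and> p > 3 / 2 \<and> \<epsilon> > 0 \<and>
        (\<forall>i j. O_deriv 2 (- q) (\<lambda>x. metric_deviation g x $ i $ j)) \<and>
        (\<forall>i j. O_deriv 1 (- p) (\<lambda>x. k x $ i $ j)) \<and>
        energy_density g k \<in> O[at_infinity](\<lambda>x. norm x powr (- 3 - \<epsilon>)) \<and>
        covector_norm g (momentum_density g k) \<in> O[at_infinity](\<lambda>x. norm x powr (- 3 - \<epsilon>)))"

definition energy_flux :: "tensor_field \<Rightarrow> real^3 \<Rightarrow> real" where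
  "energy_flux g x =
     (\<Sum>j\<in>UNIV. \<Sum>k\<in>UNIV.
        (partial_deriv k (\<lambda>y. g y $ j $ k) x - partial_deriv j (\<lambda>y. g y $ k $ k) x)
        * (x $ j / norm x))"

definition has_ADM_energy :: "tensor_field \<Rightarrow> real \<Rightarrow> bool" where
  "has_ADM_energy g E \<longleftrightarrow>
     ((\<lambda>r. 1 / (16 * pi) * sphere_integral r (energy_flux g)) \<longlongrightarrow> E) at_top"

definition has_ADM_momentum :: "tensor_field \<Rightarrow> tensor_field \<Rightarrow> real^3 \<Rightarrow> bool" where
  "has_ADM_momentum g k P \<longleftrightarrow>
     (\<forall>i. ((\<lambda>r. 1 / (8 * pi) * sphere_integral r (\<lambda>x.
             \<Sum>j\<in>UNIV. conjugate_momentum g k x $ i $ j * (x $ j / norm x))) \<longlongrightarrow> P $ i) at_top)"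

text \<open>No division by the energy takes place, so the center of mass makes sense when \<open>E = 0\<close>.\<close>

definition has_BORT_center :: "tensor_field \<Rightarrow> real^3 \<Rightarrow> bool" where
  "has_BORT_center g C \<longleftrightarrow>
     (\<forall>i. ((\<lambda>r. 1 / (16 * pi) * sphere_integral r (\<lambda>x.
             x $ i * energy_flux g x
             - (\<Sum>k\<in>UNIV. metric_deviation g x $ k $ i * (x $ k / norm x)
                          - metric_deviation g x $ k $ k * (x $ i / norm x)))) \<longlongrightarrow> C $ i) at_top)"


section \<open>The geometry of a graph in terms of its defining function\<close>

lemma partial_deriv_graph_map:
  assumes "f differentiable (at x)"
  shows "partial_deriv i (graph_map f) x = (partial_deriv i f x, axis i 1)"
proof -
  have "(f has_derivative frechet_derivative f (at x)) (at x)"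
    using assms frechet_derivative_works by blast
  then have "((\<lambda>y. (f y, y)) has_derivative (\<lambda>h. (frechet_derivative f (at x) h, h))) (at x)"
    by (intro has_derivative_Pair has_derivative_ident)
  then have "frechet_derivative (graph_map f) (at x) = (\<lambda>h. (frechet_derivative f (at x) h, h))"
    unfolding graph_map_def[abs_def] by (rule frechet_derivative_at[symmetric])
  then show ?thesis
    by (simp add: partial_deriv_def)
qed

lemma induced_metric_graph:
  assumes "f differentiable (at x)"
  shows "induced_metric f x $ i $ j =
           (if i = j then 1 else 0) - partial_deriv i f x * partial_deriv j f x"
  by (simp add: induced_metric_def minkowski_def partial_deriv_graph_map[OF assms] inner_axis_axis)

lemma spacelike_graph_iff:
  assumes "\<And>x. f differentiable (at x)"
  shows "spacelike_graph f \<longleftrightarrow> (\<forall>x. norm (gradient f x) < 1)"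
proof -
  have g: "v \<bullet> (induced_metric f x *v v) = (norm v)\<^sup>2 - (gradient f x \<bullet> v)\<^sup>2" for x v
  proof -
    have "induced_metric f x *v v = v - (gradient f x \<bullet> v) *\<^sub>R gradient f x"
    proof (rule vec_eq_iff[THEN iffD2], rule allI)
      fix i
      have "(induced_metric f x *v v) $ i =
              (\<Sum>j\<in>UNIV. (if i = j then v $ j else 0)
                 - partial_deriv i f x * (partial_deriv j f x * v $ j))"
        unfolding matrix_vector_mult_def vec_lambda_beta
        by (rule sum.cong) (auto simp: induced_metric_graph[OF assms] left_diff_distrib mult.assoc)
      also have "\<dots> = v $ i - partial_deriv i f x * (gradient f x \<bullet> v)"
        by (simp add: sum_subtractf sum_distrib_left[symmetric] inner_vec_def gradient_def)
      finally show "(induced_metric f x *v v) $ i =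
          (v - (gradient f x \<bullet> v) *\<^sub>R gradient f x) $ i"
        by (simp add: gradient_def)
    qed
    then show ?thesis
      by (simp add: inner_diff_right dot_square_norm inner_commute power2_eq_square[of "inner _ _"])
  qed
  show ?thesis
  proof
    assume L: "spacelike_graph f"
    show "\<forall>x. norm (gradient f x) < 1"
    proof
      fix x
      let ?G = "gradient f x"
      show "norm ?G < 1"
      proof (cases "?G = 0")
        case False
        then have "(norm ?G)\<^sup>2 - (?G \<bullet> ?G)\<^sup>2 > 0"
          using L g unfolding spacelike_graph_def by metis
        then have "(norm ?G)\<^sup>2 * (1 - (norm ?G)\<^sup>2) > 0"
          by (simp add: power2_norm_eq_inner[symmetric] algebra_simps power2_eq_square)
        then have "(norm ?G)\<^sup>2 < 1"
          by (simp add: zero_less_mult_iff)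
        then show ?thesis
          by (simp add: power_less_one_iff)
      qed simp
    qed
  next
    assume R: "\<forall>x. norm (gradient f x) < 1"
    show "spacelike_graph f"
      unfolding spacelike_graph_def
    proof (intro allI impI)
      fix x v :: "real^3"
      assume "v \<noteq> 0"
      have "\<bar>gradient f x \<bullet> v\<bar> \<le> norm (gradient f x) * norm v"
        by (rule Cauchy_Schwarz_ineq2)
      also have "\<dots> < 1 * norm v"
        using R \<open>v \<noteq> 0\<close> by (intro mult_strict_right_mono) auto
      finally have "\<bar>gradient f x \<bullet> v\<bar>\<^sup>2 < (norm v)\<^sup>2"
        by (intro power_strict_mono) auto
      then show "v \<bullet> (induced_metric f x *v v) > 0"
        by (simp add: g)
    qed
  qed
qed

lemma unit_normal_graph:
  assumes "f differentiable (at x)" "norm (gradient f x) < 1"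
  shows "minkowski (unit_normal f x) (unit_normal f x) = - 1"
    and "minkowski (unit_normal f x) (partial_deriv i (graph_map f) x) = 0"
    and "fst (unit_normal f x) > 0"
proof -
  let ?G = "gradient f x"
  have pos: "1 - (norm ?G)\<^sup>2 > 0"
    using assms(2) by (simp add: power_less_one_iff)
  define s where "s = 1 / sqrt (1 - (norm ?G)\<^sup>2)"
  have s: "s > 0" "s\<^sup>2 * (1 - (norm ?G)\<^sup>2) = 1"
    using pos by (auto simp: s_def power_divide)
  have n: "unit_normal f x = (s, s *\<^sub>R ?G)"
    by (simp add: unit_normal_def s_def)
  have "minkowski (unit_normal f x) (unit_normal f x) = - (s\<^sup>2 * (1 - (norm ?G)\<^sup>2))"
    unfolding n minkowski_def power2_norm_eq_inner
    by (simp add: algebra_simps power2_eq_square)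
  then show "minkowski (unit_normal f x) (unit_normal f x) = - 1"
    using s by simp
  show "minkowski (unit_normal f x) (partial_deriv i (graph_map f) x) = 0"
    unfolding n minkowski_def partial_deriv_graph_map[OF assms(1)]
    by (simp add: inner_axis gradient_def)
  show "fst (unit_normal f x) > 0"
    using s by (simp add: n)
qed

lemma second_fundamental_form_graph:
  assumes "smooth f"
  shows "second_fundamental_form f x $ i $ j =
           partial_deriv i (partial_deriv j f) x / sqrt (1 - (norm (gradient f x))\<^sup>2)"
proof -
  have d0: "f differentiable (at y)" for y
    using assms[unfolded smooth_def, rule_format, of "[]" y] by (simp add: iter_partial_def)
  have d1: "partial_deriv j f differentiable (at x)"
    using assms[unfolded smooth_def, rule_format, of "[j]" x] by (simp add: iter_partial_def)
  have eq: "partial_deriv j (graph_map f) = (\<lambda>y. (partial_deriv j f y, axis j 1))"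
    using partial_deriv_graph_map[OF d0] by blast
  have "((\<lambda>y. (partial_deriv j f y, axis j 1 :: real^3)) has_derivative
          (\<lambda>h. (frechet_derivative (partial_deriv j f) (at x) h, 0))) (at x)"
    using d1 frechet_derivative_works by (intro has_derivative_Pair has_derivative_const) blast
  then have "frechet_derivative (\<lambda>y. (partial_deriv j f y, axis j 1 :: real^3)) (at x) =
          (\<lambda>h. (frechet_derivative (partial_deriv j f) (at x) h, 0))"
    by (rule frechet_derivative_at[symmetric])
  then have "partial_deriv i (partial_deriv j (graph_map f)) x =
          (partial_deriv i (partial_deriv j f) x, 0)"
    unfolding eq by (simp add: partial_deriv_def)
  then show ?thesis
    by (simp add: second_fundamental_form_def minkowski_def unit_normal_def)
qed

end

theory Submission
  imports Defs "HOL-Real_Asymp.Real_Asymp"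
begin

text \<open>The graph function is \<open>f = (log \<langle>x\<rangle> + x\<^sub>3 / \<langle>x\<rangle>) / 4\<close> with
  \<open>\<langle>x\<rangle> = sqrt (1 + |x|\<^sup>2)\<close>. Its gradient decays like \<open>1 / r\<close>, so \<open>g - \<delta>\<close> and \<open>k\<close> are
  \<open>O(r\<^bsup>- 2\<^esup>)\<close>: the energy flux is \<open>O(r\<^bsup>- 3\<^esup>)\<close> and \<open>E = 0\<close>, whereas the integrand of the center
  of mass is of the critical order \<open>r\<^bsup>- 2\<^esup>\<close>. It is quadratic in \<open>f\<close>, so by parity only the cross term
  of the even part \<open>log \<langle>x\<rangle>\<close> and the odd part \<open>x\<^sub>3 / \<langle>x\<rangle>\<close> contributes, and this term yields
  \<open>C\<^sup>3 = 1 / 48\<close>. The momentum flux is linear in \<open>f\<close> up to \<open>O(r\<^bsup>- 4\<^esup>)\<close>, and its linear part is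
  divergence free, hence integrates to zero over every sphere. In \<open>J\<close> the terms linear in \<open>f\<close>
  cancel because third derivatives commute.\<close>

section \<open>Partial derivatives\<close>

lemma partial_derivI:
  assumes "(F has_derivative F') (at x)"
  shows "partial_deriv i F x = F' (axis i 1)"
  using frechet_derivative_at[OF assms] by (simp add: partial_deriv_def)

lemma has_derivative_partial_deriv:
  assumes "F differentiable at x"
  shows "(F has_derivative frechet_derivative F (at x)) (at x)"
  using assms frechet_derivative_works by blast

lemma partial_deriv_const: "partial_deriv i (\<lambda>_. c) x = 0"
  by (rule partial_derivI[OF has_derivative_const])

lemma partial_deriv_coord: "partial_deriv i (\<lambda>x. x $ j) x = (if i = j then 1 else 0)"
proof -
  have "((\<lambda>x. x $ j) has_derivative (\<lambda>h. h $ j)) (at x)" for x :: "real^3"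
    by (rule bounded_linear_imp_has_derivative[OF bounded_linear_vec_nth])
  from partial_derivI[OF this, of i x] show ?thesis by (auto simp: axis_def)
qed

lemma partial_deriv_add:
  assumes "F differentiable at x" "G differentiable at x"
  shows "partial_deriv i (\<lambda>x. F x + G x) x = partial_deriv i F x + partial_deriv i G x"
  by (subst partial_derivI[OF has_derivative_add[OF assms[THEN has_derivative_partial_deriv]]])
     (simp add: partial_deriv_def)

lemma partial_deriv_diff:
  assumes "F differentiable at x" "G differentiable at x"
  shows "partial_deriv i (\<lambda>x. F x - G x) x = partial_deriv i F x - partial_deriv i G x"
  by (subst partial_derivI[OF has_derivative_diff[OF assms[THEN has_derivative_partial_deriv]]])
     (simp add: partial_deriv_def)

lemma partial_deriv_mult:
  fixes F G :: "real^3 \<Rightarrow> real"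
  assumes "F differentiable at x" "G differentiable at x"
  shows "partial_deriv i (\<lambda>x. F x * G x) x = partial_deriv i F x * G x + F x * partial_deriv i G x"
  by (subst partial_derivI[OF has_derivative_mult[OF assms[THEN has_derivative_partial_deriv]]])
     (simp add: partial_deriv_def)

lemma partial_deriv_sum:
  fixes F :: "'i \<Rightarrow> real^3 \<Rightarrow> real"
  assumes "\<And>a. a \<in> A \<Longrightarrow> F a differentiable at x"
  shows "partial_deriv i (\<lambda>x. \<Sum>a\<in>A. F a x) x = (\<Sum>a\<in>A. partial_deriv i (F a) x)"
  by (subst partial_derivI[OF has_derivative_sum[OF assms[THEN has_derivative_partial_deriv]]])
     (auto simp add: partial_deriv_def)

lemma partial_deriv_chain:
  fixes F :: "real^3 \<Rightarrow> real"
  assumes "F differentiable at x" "(h has_real_derivative h') (at (F x))"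
  shows "(\<lambda>x. h (F x)) differentiable at x"
    and "partial_deriv i (\<lambda>x. h (F x)) x = h' * partial_deriv i F x"
proof -
  have D: "((\<lambda>x. h (F x)) has_derivative (\<lambda>y. h' * frechet_derivative F (at x) y)) (at x)"
    by (rule has_derivative_compose[OF has_derivative_partial_deriv[OF assms(1)]
          assms(2)[unfolded has_field_derivative_def]])
  show "(\<lambda>x. h (F x)) differentiable at x"
    using D differentiableI by blast
  show "partial_deriv i (\<lambda>x. h (F x)) x = h' * partial_deriv i F x"
    by (subst partial_derivI[OF D]) (simp add: partial_deriv_def)
qed

text \<open>A substitute for \<open>1 / norm x\<close> that is smooth at the origin, so that one
  formula defines the graph over all of \<open>real^3\<close> with the same decay at
  infinity.\<close>

definition inv_bracket :: "real^3 \<Rightarrow> real" where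
  "inv_bracket x = 1 / sqrt (1 + x \<bullet> x)"

lemma inv_bracket_sq: "(inv_bracket x)\<^sup>2 * (1 + x \<bullet> x) = 1"
  and inv_bracket_pos: "inv_bracket x > 0"
  and inv_bracket_le_1: "inv_bracket x \<le> 1"
  and inv_bracket_mult_norm: "inv_bracket x * norm x \<le> 1"
proof -
  have p: "1 + x \<bullet> x > 0"
    by (rule add_pos_nonneg) auto
  then have nz: "1 + x \<bullet> x \<noteq> 0"
    by linarith
  show "(inv_bracket x)\<^sup>2 * (1 + x \<bullet> x) = 1"
    using p nz by (simp add: inv_bracket_def power_divide)
  show "inv_bracket x > 0"
    using p by (simp add: inv_bracket_def)
  show "inv_bracket x \<le> 1"
    using p by (simp add: inv_bracket_def)
  have "norm x \<le> sqrt (1 + x \<bullet> x)"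
    by (simp add: norm_eq_sqrt_inner)
  then show "inv_bracket x * norm x \<le> 1"
    using p by (simp add: inv_bracket_def)
qed

lemma
  shows differentiable_dot_self: "(\<lambda>x::real^3. x \<bullet> x) differentiable at x"
    and partial_deriv_dot_self: "partial_deriv i (\<lambda>x. x \<bullet> x) x = 2 * x $ i"
proof -
  have D: "((\<lambda>x::real^3. x \<bullet> x) has_derivative (\<lambda>h. x \<bullet> h + h \<bullet> x)) (at x)"
    by (intro has_derivative_inner has_derivative_ident)
  show "(\<lambda>x::real^3. x \<bullet> x) differentiable at x"
    using D differentiableI by blast
  show "partial_deriv i (\<lambda>x. x \<bullet> x) x = 2 * x $ i"
    by (subst partial_derivI[OF D]) (simp add: inner_axis inner_axis')
qed

lemma
  shows differentiable_inv_bracket: "inv_bracket differentiable at x"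
    and partial_deriv_inv_bracket: "partial_deriv i inv_bracket x = - (inv_bracket x ^ 3 * x $ i)"
proof -
  have p: "1 + x \<bullet> x > 0" by (smt (verit) inner_ge_zero)
  have h: "((\<lambda>y. 1 / sqrt (1 + y)) has_real_derivative - (1 / (2 * sqrt (1 + x \<bullet> x) ^ 3))) (at (x \<bullet> x))"
    using p by (auto intro!: derivative_eq_intros simp: field_simps power3_eq_cube)
  note * = partial_deriv_chain[OF differentiable_dot_self h, folded inv_bracket_def]
  show "inv_bracket differentiable at x"
    using *(1) by (simp add: inv_bracket_def[abs_def])
  show "partial_deriv i inv_bracket x = - (inv_bracket x ^ 3 * x $ i)"
    using *(2) p by (simp add: inv_bracket_def[abs_def] partial_deriv_dot_self power_divide)
qed

section \<open>Symbols\<close>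

text \<open>A syntactic substitute for the classical symbol classes: \<open>symbol d F\<close> implies that \<open>F\<close> is smooth
  and that its derivatives of order \<open>s\<close> are \<open>O(r\<^bsup>d - s\<^esup>)\<close> for every \<open>s\<close>. Closure under differentiation
  and the bound at infinity are then simple inductions. The offset \<open>- 1\<close> in the last rule makes
  the normalisation of the unit normal differ from 1 by a decaying symbol.\<close>

inductive symbol :: "real \<Rightarrow> (real^3 \<Rightarrow> real) \<Rightarrow> bool" where
  symbol_const: "symbol 0 (\<lambda>_. c)"
| symbol_coord: "symbol 1 (\<lambda>x. x $ i)"
| symbol_inv_bracket: "symbol (- 1) inv_bracket"
| symbol_add: "symbol d F \<Longrightarrow> symbol d G \<Longrightarrow> symbol d (\<lambda>x. F x + G x)"
| symbol_mult_exact: "symbol d F \<Longrightarrow> symbol e G \<Longrightarrow> symbol (d + e) (\<lambda>x. F x * G x)"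
| symbol_mono: "symbol d F \<Longrightarrow> d \<le> e \<Longrightarrow> symbol e F"
| symbol_inverse_sqrt: "symbol d F \<Longrightarrow> d \<le> 0 \<Longrightarrow> b < 1 \<Longrightarrow> (\<And>x. F x \<le> b) \<Longrightarrow>
    symbol d (\<lambda>x. 1 / sqrt (1 - F x) - 1)"

lemma symbol_mult:
  assumes "symbol d F" "symbol e G" "d + e \<le> c"
  shows "symbol c (\<lambda>x. F x * G x)"
  using symbol_mono[OF symbol_mult_exact[OF assms(1,2)] assms(3)] .

lemma symbol_cmult: "symbol d F \<Longrightarrow> symbol d (\<lambda>x. c * F x)"
  by (rule symbol_mult[OF symbol_const]) auto

lemma symbol_minus: "symbol d F \<Longrightarrow> symbol d (\<lambda>x. - F x)"
  using symbol_cmult[of d F "- 1"] by simp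

lemma symbol_diff: "symbol d F \<Longrightarrow> symbol d G \<Longrightarrow> symbol d (\<lambda>x. F x - G x)"
  using symbol_add[of d F "\<lambda>x. - G x"] symbol_minus[of d G] by simp

text \<open>\<open>symbol_const\<close> gives the zero function order 0 only; repeated
  multiplication by \<open>inv_bracket\<close> lowers the order without bound. Derivatives of
  constants and empty sums use this.\<close>

lemma symbol_zero: "symbol d (\<lambda>_. 0)"
proof -
  have "symbol (- real n) (\<lambda>_. 0)" for n
  proof (induction n)
    case (Suc n)
    show ?case
      using symbol_mult[OF Suc symbol_inv_bracket order.refl] by (simp add: algebra_simps)
  qed (simp add: symbol_const)
  moreover obtain n where "- d \<le> real n"
    using real_arch_simple by blast
  ultimately show ?thesis
    by (intro symbol_mono[of "- real n" _ d]) auto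
qed

lemma symbol_sum: "(\<And>a. a \<in> A \<Longrightarrow> symbol d (F a)) \<Longrightarrow> symbol d (\<lambda>x. \<Sum>a\<in>A. F a x)"
  by (induction A rule: infinite_finite_induct) (auto simp: symbol_zero intro: symbol_add)

lemma symbol_power: "symbol d F \<Longrightarrow> symbol (real n * d) (\<lambda>x. F x ^ n)"
  by (induction n) (auto simp: symbol_const algebra_simps intro: symbol_mult)

text \<open>Both claims go through one induction because the sum, product and chain rules presuppose
  differentiability of the parts.\<close>

lemma symbol_differentiable_partial:
  assumes "symbol d F"
  shows "(\<forall>x. F differentiable at x) \<and> (\<forall>i. symbol (d - 1) (partial_deriv i F))"
  using assms
proof (induction rule: symbol.induct)
  case (symbol_const c)
  then show ?case
    by (auto simp: partial_deriv_const[abs_def] symbol_zero)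
next
  case (symbol_coord j)
  have "(\<lambda>x::real^3. x $ j) differentiable at x" for x
    using bounded_linear_imp_differentiable[OF bounded_linear_vec_nth] .
  moreover have "partial_deriv i (\<lambda>x. x $ j) = (\<lambda>_. if i = j then 1 else 0)" for i
    using partial_deriv_coord by blast
  ultimately show ?case
    by (simp add: symbol.symbol_const)
next
  case symbol_inv_bracket
  have "partial_deriv i inv_bracket = (\<lambda>x. - (inv_bracket x ^ 3 * x $ i))" for i
    using partial_deriv_inv_bracket by blast
  moreover have "symbol (- 2) (\<lambda>x. - (inv_bracket x ^ 3 * x $ i))" for i
    by (intro symbol_minus symbol_mult[OF symbol_power[OF symbol.symbol_inv_bracket] symbol.symbol_coord])
      simp
  ultimately show ?case
    by (simp add: differentiable_inv_bracket)
next
  case (symbol_add d F G)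
  then have "partial_deriv i (\<lambda>x. F x + G x) = (\<lambda>x. partial_deriv i F x + partial_deriv i G x)" for i
    using partial_deriv_add by blast
  with symbol_add show ?case
    by (auto intro: symbol.symbol_add)
next
  case (symbol_mult_exact d F e G)
  then have "partial_deriv i (\<lambda>x. F x * G x) =
      (\<lambda>x. partial_deriv i F x * G x + F x * partial_deriv i G x)" for i
    using partial_deriv_mult by blast
  moreover have "symbol (d + e - 1) (\<lambda>x. partial_deriv i F x * G x + F x * partial_deriv i G x)" for i
    using symbol_mult_exact
    by (intro symbol.symbol_add symbol_mult[of "d - 1" _ e] symbol_mult[of d _ "e - 1"]) auto
  ultimately show ?case
    using symbol_mult_exact by auto
next
  case (symbol_mono d F e)
  then show ?case
    by (auto intro: symbol.symbol_mono)
next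
  case (symbol_inverse_sqrt d F b)
  have pos: "1 - F x > 0" for x
    using symbol_inverse_sqrt.hyps(3) symbol_inverse_sqrt.hyps(4)[of x] by linarith
  \<comment> \<open>The inverse square root is written as 1 plus the function being differentiated;
    its cube is then a symbol of order 0, and so is the outer derivative.\<close>
  have h: "((\<lambda>y. 1 / sqrt (1 - y) - 1) has_real_derivative
      1 / 2 * (1 + (1 / sqrt (1 - F x) - 1)) ^ 3) (at (F x))" for x
    using pos[of x] by (auto intro!: derivative_eq_intros simp: field_simps power3_eq_cube)
  have F: "F differentiable at x" for x
    using symbol_inverse_sqrt.IH by blast
  note * = partial_deriv_chain[OF F h]
  have "symbol 0 (\<lambda>x. 1 + (1 / sqrt (1 - F x) - 1))"
    by (intro symbol.symbol_add symbol.symbol_const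
        symbol.symbol_mono[OF symbol.symbol_inverse_sqrt[OF symbol_inverse_sqrt.hyps] \<open>d \<le> 0\<close>])
  from symbol_power[OF this, of 3]
  have "symbol 0 (\<lambda>x. 1 / 2 * (1 + (1 / sqrt (1 - F x) - 1)) ^ 3)"
    by (intro symbol_cmult) simp
  then have "symbol (d - 1)
      (\<lambda>x. 1 / 2 * (1 + (1 / sqrt (1 - F x) - 1)) ^ 3 * partial_deriv i F x)" for i
    by (rule symbol_mult) (use symbol_inverse_sqrt.IH in auto)
  with * show ?case
    by presburger
qed

lemma symbol_differentiable: "symbol d F \<Longrightarrow> F differentiable at x"
  using symbol_differentiable_partial by blast

lemma symbol_partial: "symbol d F \<Longrightarrow> symbol (d - 1) (partial_deriv i F)"
  using symbol_differentiable_partial by blast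

lemma symbol_continuous: "symbol d F \<Longrightarrow> continuous_on A F"
  by (meson symbol_differentiable continuous_at_imp_continuous_on differentiable_imp_continuous_within)

lemma symbol_iter_partial: "symbol d F \<Longrightarrow> symbol (d - real (length is)) (iter_partial is F)"
proof (induction "is")
  case (Cons i js)
  then show ?case
    using symbol_partial[of "d - real (length js)" "iter_partial js F" i]
    by (simp add: iter_partial_def algebra_simps)
qed (simp add: iter_partial_def)

section \<open>Bounds on symbols at infinity\<close>

lemma eventually_norm_ge: "\<forall>\<^sub>F x in at_infinity. norm (x :: real^3) \<ge> c"
  unfolding eventually_at_infinity by blast

lemma norm_powr_bigo_mono:
  assumes "d \<le> e"
  shows "(\<lambda>x::real^3. norm x powr d) \<in> O[at_infinity](\<lambda>x. norm x powr e)"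
proof (rule bigoI[of _ 1])
  show "\<forall>\<^sub>F x::real^3 in at_infinity. norm (norm x powr d) \<le> 1 * norm (norm x powr e)"
    using eventually_norm_ge[of 1]
    by eventually_elim (use assms in \<open>auto intro: powr_mono\<close>)
qed

text \<open>Coordinates are at most \<open>norm x\<close> and \<open>inv_bracket x\<close> is at
  most \<open>1 / norm x\<close>; sums, products and larger exponents preserve such bounds. The
  inverse square root takes an estimate of its own.\<close>

lemma symbol_bigo: "symbol d F \<Longrightarrow> F \<in> O[at_infinity](\<lambda>x. norm x powr d)"
proof (induction rule: symbol.induct)
  case (symbol_const c)
  show ?case
    by (rule bigoI[of _ "\<bar>c\<bar>"]) (use eventually_norm_ge[of 1] in \<open>eventually_elim, auto\<close>)
next
  case (symbol_coord i)
  show ?case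
    by (rule bigoI[of _ 1]) (auto simp: component_le_norm_cart)
next
  case symbol_inv_bracket
  show ?case
  proof (rule bigoI[of _ 1])
    show "\<forall>\<^sub>F x::real^3 in at_infinity. norm (inv_bracket x) \<le> 1 * norm (norm x powr - 1)"
      using eventually_norm_ge[of 1]
    proof eventually_elim
      case (elim x)
      then have "x \<noteq> 0"
        by auto
      then show ?case
        using inv_bracket_pos[of x] inv_bracket_mult_norm[of x]
        by (simp add: powr_minus divide_inverse[symmetric] pos_le_divide_eq)
    qed
  qed
next
  case (symbol_add d F G)
  then show ?case
    by (intro sum_in_bigo)
next
  case (symbol_mult_exact d F e G)
  then show ?case
    unfolding powr_add by (intro landau_o.big.mult)
next
  case (symbol_mono d F e)
  then show ?case
    using norm_powr_bigo_mono landau_o.big_trans by blast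
next
  case (symbol_inverse_sqrt d F b)
  have "norm (1 / sqrt (1 - F x) - 1) \<le> 1 / sqrt (1 - b) * norm (F x)" for x
  proof -
    define m where "m = sqrt (1 - F x)"
    have b: "F x \<le> b" "b < 1" using symbol_inverse_sqrt by auto
    then have m: "m \<ge> sqrt (1 - b)" "sqrt (1 - b) > 0" "m > 0" "F x = 1 - m\<^sup>2"
      by (auto simp: m_def)
    \<comment> \<open>This makes \<open>1 / m - 1\<close> proportional to \<open>F x\<close>, and
      \<open>m\<close> stays away from 0 because \<open>F\<close> is bounded by
      \<open>b < 1\<close>.\<close>
    have "F x = (1 - m) * (1 + m)"
      using m(4) by (simp add: power2_eq_square algebra_simps)
    then have "1 / m - 1 = F x / (m * (1 + m))"
      using m(3) by (simp add: diff_divide_distrib)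
    also have "\<bar>\<dots>\<bar> = \<bar>F x\<bar> / (m * (1 + m))"
      using m by (simp add: abs_mult)
    also have "\<dots> \<le> \<bar>F x\<bar> / sqrt (1 - b)"
    proof (rule divide_left_mono)
      have "sqrt (1 - b) * 1 \<le> m * (1 + m)"
        using m by (intro mult_mono) auto
      then show "sqrt (1 - b) \<le> m * (1 + m)" by simp
    qed (use m in auto)
    finally show ?thesis
      by (simp add: m_def)
  qed
  then have "(\<lambda>x. 1 / sqrt (1 - F x) - 1) \<in> O[at_infinity](F)"
    by (intro bigoI[of _ "1 / sqrt (1 - b)"]) auto
  then show ?case
    using symbol_inverse_sqrt.IH landau_o.big_trans by blast
qed

lemma symbol_O_deriv: "symbol d F \<Longrightarrow> O_deriv l d F"
  unfolding O_deriv_def using symbol_bigo symbol_iter_partial by blast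

section \<open>Decaying initial data\<close>

text \<open>\<open>matrix_inv\<close> is a Hilbert choice; associativity forces the chosen matrix to
  agree with any explicit two-sided inverse.\<close>

lemma matrix_inv_unique:
  fixes A B :: "'a::semiring_1^'n^'n"
  assumes "A ** B = mat 1" "B ** A = mat 1"
  shows "matrix_inv A = B"
proof -
  have "A ** matrix_inv A = mat 1 \<and> matrix_inv A ** A = mat 1"
    unfolding matrix_inv_def by (rule someI) (use assms in blast)
  then show ?thesis
    by (metis assms(1) matrix_mul_assoc matrix_mul_lid matrix_mul_rid)
qed

text \<open>Decay of the inverse metric is a separate assumption; for a graph it follows from a
  closed formula for the inverse.\<close>

locale decaying_metric =
  fixes g :: tensor_field and q :: real
  assumes q_nonneg: "q \<ge> 0"
    and symbol_deviation: "\<And>i j. symbol (- q) (\<lambda>x. metric_deviation g x $ i $ j)"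
    and symbol_inv_deviation: "\<And>i j. symbol (- q) (\<lambda>x. (matrix_inv (g x) - mat 1) $ i $ j)"
begin

lemma symbol_partial_metric: "symbol (- q - 1) (partial_deriv a (\<lambda>y. g y $ i $ j))"
proof -
  have "partial_deriv a (\<lambda>y. g y $ i $ j) = partial_deriv a (\<lambda>y. metric_deviation g y $ i $ j)"
  proof
    fix x
    have "(\<lambda>y. g y $ i $ j) = (\<lambda>y. metric_deviation g y $ i $ j + mat 1 $ i $ j)"
      by (simp add: metric_deviation_def)
    then show "partial_deriv a (\<lambda>y. g y $ i $ j) x = partial_deriv a (\<lambda>y. metric_deviation g y $ i $ j) x"
      using partial_deriv_add[OF symbol_differentiable[OF symbol_deviation] differentiable_const]
      by (simp add: partial_deriv_const)
  qed
  then show ?thesis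
    using symbol_partial[OF symbol_deviation] by simp
qed

lemma symbol_metric_inv: "symbol 0 (\<lambda>x. matrix_inv (g x) $ i $ j)"
proof -
  have "symbol 0 (\<lambda>x. (matrix_inv (g x) - mat 1) $ i $ j + mat 1 $ i $ j)"
    using q_nonneg by (intro symbol_add symbol_const symbol_mono[OF symbol_inv_deviation]) auto
  then show ?thesis
    by simp
qed

lemma symbol_christoffel: "symbol (- q - 1) (christoffel g l i j)"
  unfolding christoffel_def[abs_def]
  by (intro symbol_cmult symbol_sum symbol_mult[OF symbol_metric_inv, of "- q - 1"] symbol_add
      symbol_diff symbol_partial_metric) auto

text \<open>The quadratic terms have order \<open>- 2 * q - 2\<close>, which is no worse than that
  of the differentiated Christoffel symbols since \<open>q \<ge> 0\<close>.\<close>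

lemma symbol_ricci: "symbol (- q - 2) (ricci g i j)"
proof -
  have 1: "symbol (- q - 2) (partial_deriv a (christoffel g l m n))" for a l m n
    by (rule symbol_mono[OF symbol_partial[OF symbol_christoffel]]) simp
  have 2: "symbol (- q - 2) (\<lambda>x. christoffel g a b c x * christoffel g l m n x)" for a b c l m n
    using q_nonneg by (intro symbol_mult[OF symbol_christoffel symbol_christoffel]) auto
  show ?thesis
    unfolding ricci_def[abs_def]
    by (intro symbol_sum symbol_add symbol_diff 1 2)
qed

lemma symbol_metric_trace:
  assumes "\<And>i j. symbol d (\<lambda>x. h x $ i $ j)"
  shows "symbol d (metric_trace g h)"
  unfolding metric_trace_def[abs_def]
  by (intro symbol_sum symbol_mult[OF symbol_metric_inv assms]) auto

lemma symbol_scalar_curvature: "symbol (- q - 2) (scalar_curvature g)"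
  unfolding scalar_curvature_def[abs_def]
  using symbol_ricci by (intro symbol_metric_trace) simp

lemma symbol_tensor_norm_sq:
  assumes "\<And>i j. symbol d (\<lambda>x. h x $ i $ j)"
  shows "symbol (2 * d) (tensor_norm_sq g h)"
proof -
  have "symbol 0 (\<lambda>x. matrix_inv (g x) $ i $ a * matrix_inv (g x) $ j $ b)" for i j a b
    by (intro symbol_mult[OF symbol_metric_inv symbol_metric_inv]) auto
  then have "symbol d (\<lambda>x. matrix_inv (g x) $ i $ a * matrix_inv (g x) $ j $ b * h x $ i $ j)" for i j a b
    by (rule symbol_mult[OF _ assms]) auto
  then show ?thesis
    unfolding tensor_norm_sq_def[abs_def]
    by (intro symbol_sum) (rule symbol_mult[OF _ assms], auto)
qed

lemma symbol_energy_density: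
  assumes "\<And>i j. symbol d (\<lambda>x. h x $ i $ j)" "- q - 2 \<le> e" "2 * d \<le> e"
  shows "symbol e (energy_density g h)"
  unfolding energy_density_def[abs_def]
  using symbol_mono[OF symbol_scalar_curvature assms(2)]
    symbol_mono[OF symbol_tensor_norm_sq[OF assms(1)] assms(3)]
    symbol_mono[OF symbol_power[OF symbol_metric_trace[OF assms(1)], of 2], of e] assms(3)
  by (intro symbol_cmult symbol_add symbol_diff) auto

lemma symbol_metric_trace_deviation:
  assumes "\<And>i j. symbol d (\<lambda>x. h x $ i $ j)"
  shows "symbol (d - q) (\<lambda>x. metric_trace g h x - (\<Sum>i\<in>UNIV. h x $ i $ i))"
proof -
  have "metric_trace g h x - (\<Sum>i\<in>UNIV. h x $ i $ i) =
      (\<Sum>i\<in>UNIV. \<Sum>j\<in>UNIV. (matrix_inv (g x) - mat 1) $ i $ j * h x $ i $ j)" for x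
    by (simp add: metric_trace_def mat_def left_diff_distrib sum_subtractf if_distrib[of "\<lambda>a. a * _"]
        cong: if_cong)
  moreover have "symbol (d - q)
      (\<lambda>x. \<Sum>i\<in>UNIV. \<Sum>j\<in>UNIV. (matrix_inv (g x) - mat 1) $ i $ j * h x $ i $ j)"
    by (intro symbol_sum symbol_mult[OF symbol_inv_deviation assms]) auto
  ultimately show ?thesis
    by simp
qed

lemma symbol_covariant_deriv_deviation:
  assumes "\<And>i j. symbol d (\<lambda>x. h x $ i $ j)"
  shows "symbol (d - q - 1) (\<lambda>x. covariant_deriv g h l i j x - partial_deriv l (\<lambda>y. h y $ i $ j) x)"
proof -
  have "symbol (d - q - 1) (\<lambda>x. - (\<Sum>m\<in>UNIV. christoffel g m l i x * h x $ m $ j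
      + christoffel g m l j x * h x $ i $ m))"
    by (intro symbol_minus symbol_sum symbol_add symbol_mult[OF symbol_christoffel assms]) auto
  then show ?thesis
    by (simp add: covariant_deriv_def)
qed

lemma symbol_covariant_deriv:
  assumes "\<And>i j. symbol d (\<lambda>x. h x $ i $ j)"
  shows "symbol (d - 1) (covariant_deriv g h l i j)"
proof -
  have "symbol (d - 1) (\<lambda>x. (covariant_deriv g h l i j x - partial_deriv l (\<lambda>y. h y $ i $ j) x)
      + partial_deriv l (\<lambda>y. h y $ i $ j) x)"
    using q_nonneg
    by (intro symbol_add symbol_mono[OF symbol_covariant_deriv_deviation[OF assms]]
        symbol_partial[OF assms]) auto
  then show ?thesis
    by simp
qed

text \<open>Three replacements, each with an error that gains \<open>q\<close> orders of decay, turn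
  the momentum density into its flat counterpart: the inverse metric by the identity, the covariant
  derivative by the partial one, the metric trace by the Euclidean one.\<close>

lemma symbol_momentum_density_deviation:
  assumes "\<And>i j. symbol d (\<lambda>x. h x $ i $ j)"
  shows "symbol (d - q - 1) (\<lambda>x. momentum_density g h x $ i -
    (\<Sum>j\<in>UNIV. partial_deriv j (\<lambda>y. h y $ i $ j) x - partial_deriv i (\<lambda>y. h y $ j $ j) x))"
proof -
  let ?D = "\<lambda>x. metric_trace g h x - (\<Sum>j\<in>UNIV. h x $ j $ j)"
  have "(\<lambda>x. \<Sum>j\<in>UNIV. h x $ j $ j) differentiable at x" for x
    by (rule symbol_differentiable[OF symbol_sum[OF assms]])
  then have tr: "partial_deriv i (metric_trace g h) x =
      partial_deriv i ?D x + (\<Sum>j\<in>UNIV. partial_deriv i (\<lambda>y. h y $ j $ j) x)" for x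
    using partial_deriv_add[OF symbol_differentiable[OF symbol_metric_trace_deviation[OF assms]],
        of "\<lambda>x. \<Sum>j\<in>UNIV. h x $ j $ j" x i]
      partial_deriv_sum[where A = UNIV and F = "\<lambda>j x. h x $ j $ j", OF symbol_differentiable[OF assms]]
    by simp
  have "momentum_density g h x $ i - (\<Sum>j\<in>UNIV. partial_deriv j (\<lambda>y. h y $ i $ j) x
        - partial_deriv i (\<lambda>y. h y $ j $ j) x) =
      (\<Sum>j\<in>UNIV. \<Sum>l\<in>UNIV. (matrix_inv (g x) - mat 1) $ j $ l * covariant_deriv g h l i j x)
      + (\<Sum>j\<in>UNIV. covariant_deriv g h j i j x - partial_deriv j (\<lambda>y. h y $ i $ j) x)
      - partial_deriv i ?D x" for x
    by (simp add: momentum_density_def metric_div_def tr mat_def left_diff_distrib sum_subtractf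
        if_distrib[of "\<lambda>a. a * _"] cong: if_cong)
  moreover have "symbol (d - q - 1) (\<lambda>x.
      (\<Sum>j\<in>UNIV. \<Sum>l\<in>UNIV. (matrix_inv (g x) - mat 1) $ j $ l * covariant_deriv g h l i j x)
      + (\<Sum>j\<in>UNIV. covariant_deriv g h j i j x - partial_deriv j (\<lambda>y. h y $ i $ j) x)
      - partial_deriv i ?D x)"
    by (intro symbol_add symbol_diff symbol_sum symbol_covariant_deriv_deviation[OF assms]
        symbol_mult[OF symbol_inv_deviation symbol_covariant_deriv[OF assms]]
        symbol_partial[OF symbol_metric_trace_deviation[OF assms]]) auto
  ultimately show ?thesis
    by simp
qed

text \<open>A square root may fail to be differentiable where its argument vanishes, so the squared
  norm is treated as a symbol of order \<open>2 * d\<close> and the root is taken of the resulting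
  bound.\<close>

lemma covector_norm_bigo:
  assumes "\<And>i. symbol d (\<lambda>x. \<omega> x $ i)"
  shows "covector_norm g \<omega> \<in> O[at_infinity](\<lambda>x. norm x powr d)"
proof -
  have "symbol (2 * d) (\<lambda>x. \<Sum>i\<in>UNIV. \<omega> x $ i * (\<Sum>j\<in>UNIV. matrix_inv (g x) $ i $ j * \<omega> x $ j))"
    by (intro symbol_sum symbol_mult[OF assms] symbol_mult[OF symbol_metric_inv assms]) auto
  then have "symbol (2 * d) (\<lambda>x. \<omega> x \<bullet> (matrix_inv (g x) *v \<omega> x))"
    by (simp add: inner_vec_def matrix_vector_mult_def)
  from landau_o.bigE[OF symbol_bigo[OF this]] obtain c where c: "c > 0"
    "\<forall>\<^sub>F x in at_infinity. norm (\<omega> x \<bullet> (matrix_inv (g x) *v \<omega> x)) \<le> c * norm (norm x powr (2 * d))"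
    by blast
  show ?thesis
  proof (rule bigoI[of _ "sqrt c"])
    show "\<forall>\<^sub>F x in at_infinity. norm (covector_norm g \<omega> x) \<le> sqrt c * norm (norm x powr d)"
      using c(2)
    proof eventually_elim
      case (elim x)
      have "norm (covector_norm g \<omega> x) = sqrt \<bar>\<omega> x \<bullet> (matrix_inv (g x) *v \<omega> x)\<bar>"
        by (simp add: covector_norm_def real_sqrt_abs')
      also have "\<dots> \<le> sqrt (c * (norm x powr d)\<^sup>2)"
        using elim by (intro real_sqrt_le_mono) (simp add: power2_eq_square flip: powr_add)
      finally show ?case
        by (simp add: real_sqrt_mult)
    qed
  qed
qed

end

section \<open>Sphere integrals\<close>

lemma sphere_point_nth:
  "sphere_point r \<theta> \<phi> $ 1 = r * sin \<theta> * cos \<phi>"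
  "sphere_point r \<theta> \<phi> $ 2 = r * sin \<theta> * sin \<phi>"
  "sphere_point r \<theta> \<phi> $ 3 = r * cos \<theta>"
  by (simp_all add: sphere_point_def)

lemma norm_sphere_point: "r \<ge> 0 \<Longrightarrow> norm (sphere_point r \<theta> \<phi>) = r"
proof -
  assume "r \<ge> 0"
  have "(r * sin \<theta> * cos \<phi>)\<^sup>2 + (r * sin \<theta> * sin \<phi>)\<^sup>2 + (r * cos \<theta>)\<^sup>2 = r\<^sup>2"
    using sin_cos_squared_add[of \<theta>] sin_cos_squared_add[of \<phi>] by algebra
  then show ?thesis
    using \<open>r \<ge> 0\<close>
    by (simp only: norm_vec_def L2_set_def sum_3 sphere_point_nth real_norm_def power2_abs) simp
qed

lemma continuous_on_sphere_point:
  fixes F :: "real^3 \<Rightarrow> real"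
  assumes "continuous_on (sphere 0 r) F" "r \<ge> 0"
  shows "continuous_on A (\<lambda>(\<theta>, \<phi>). F (sphere_point r \<theta> \<phi>) * (r\<^sup>2 * sin \<theta>))"
proof -
  have eq: "sphere_point r \<theta> \<phi> = (r * sin \<theta> * cos \<phi>) *\<^sub>R axis 1 1 + (r * sin \<theta> * sin \<phi>) *\<^sub>R axis 2 1
      + (r * cos \<theta>) *\<^sub>R axis 3 1" for \<theta> \<phi>
    by (simp add: vec_eq_iff forall_3 sphere_point_nth axis_def)
  have "continuous_on A (\<lambda>p. sphere_point r (fst p) (snd p))"
    unfolding eq by (intro continuous_intros)
  then have "continuous_on A (\<lambda>p. F (sphere_point r (fst p) (snd p)))"
    using assms norm_sphere_point by (intro continuous_on_compose2[OF assms(1)]) auto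
  then show ?thesis
    unfolding case_prod_beta by (intro continuous_intros)
qed

lemma
  fixes F :: "real^3 \<Rightarrow> real"
  assumes "continuous_on (sphere 0 r) F" "r \<ge> 0"
  shows integrable_sphere_inner:
      "(\<lambda>\<phi>. F (sphere_point r \<theta> \<phi>) * (r\<^sup>2 * sin \<theta>)) integrable_on {0..2 * pi}"
    and integrable_sphere_outer:
      "(\<lambda>\<theta>. integral {0..2 * pi} (\<lambda>\<phi>. F (sphere_point r \<theta> \<phi>) * (r\<^sup>2 * sin \<theta>)))
        integrable_on {0..pi}"
proof -
  have "continuous_on {0..2 * pi} ((\<lambda>(\<theta>, \<phi>). F (sphere_point r \<theta> \<phi>) * (r\<^sup>2 * sin \<theta>)) \<circ> Pair \<theta>)"
    by (intro continuous_on_compose continuous_on_sphere_point assms continuous_intros)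
  then show "(\<lambda>\<phi>. F (sphere_point r \<theta> \<phi>) * (r\<^sup>2 * sin \<theta>)) integrable_on {0..2 * pi}"
    by (intro integrable_continuous_real) (simp add: o_def)
  have "continuous_on {0..pi}
      (\<lambda>\<theta>. integral (cbox 0 (2 * pi)) (\<lambda>\<phi>. F (sphere_point r \<theta> \<phi>) * (r\<^sup>2 * sin \<theta>)))"
    by (rule integral_continuous_on_param[OF continuous_on_sphere_point[OF assms]])
  then show "(\<lambda>\<theta>. integral {0..2 * pi} (\<lambda>\<phi>. F (sphere_point r \<theta> \<phi>) * (r\<^sup>2 * sin \<theta>)))
        integrable_on {0..pi}"
    by (intro integrable_continuous_real) simp
qed

section \<open>Linearity and decay of sphere integrals\<close>

lemma sphere_integral_add:
  assumes "continuous_on (sphere 0 r) F" "continuous_on (sphere 0 r) G" "r \<ge> 0"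
  shows "sphere_integral r (\<lambda>x. F x + G x) = sphere_integral r F + sphere_integral r G"
  unfolding sphere_integral_def
  by (simp only: distrib_right
      Henstock_Kurzweil_Integration.integral_add[OF
        integrable_sphere_inner[OF assms(1,3)] integrable_sphere_inner[OF assms(2,3)]]
      Henstock_Kurzweil_Integration.integral_add[OF
        integrable_sphere_outer[OF assms(1,3)] integrable_sphere_outer[OF assms(2,3)]])

lemma sphere_integral_cmult: "sphere_integral r (\<lambda>x. c * F x) = c * sphere_integral r F"
  unfolding sphere_integral_def by (simp add: mult.assoc)

lemma sphere_integral_cong:
  assumes "r \<ge> 0" "\<And>x. norm x = r \<Longrightarrow> F x = G x"
  shows "sphere_integral r F = sphere_integral r G"
  unfolding sphere_integral_def using assms norm_sphere_point by simp

lemma abs_integral_le: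
  fixes f :: "real \<Rightarrow> real"
  assumes "a \<le> b" "B \<ge> 0" "\<And>x. x \<in> {a..b} \<Longrightarrow> \<bar>f x\<bar> \<le> B"
  shows "\<bar>integral {a..b} f\<bar> \<le> B * (b - a)"
proof (cases "f integrable_on {a..b}")
  case True
  then have "norm (integral {a..b} f) \<le> integral {a..b} (\<lambda>_. B)"
    using assms(3) by (intro integral_norm_bound_integral integrable_const_ivl) auto
  then show ?thesis
    using assms(1) by (simp add: mult.commute)
next
  \<comment> \<open>The integral of a non-integrable function is 0 by convention, so the bound holds
    here too.\<close>
  case False
  then show ?thesis
    using assms(1,2) by (simp add: not_integrable_integral)
qed

text \<open>\<open>\<bar>sin \<theta>\<bar>\<close> is bounded by 1 over a parameter rectangle of
  area \<open>2 * pi\<^sup>2\<close>, a crude replacement for \<open>4 * pi\<close> that suffices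
  for limits.\<close>

lemma abs_sphere_integral_le:
  assumes "r \<ge> 0" "B \<ge> 0" "\<And>x. norm x = r \<Longrightarrow> \<bar>F x\<bar> \<le> B"
  shows "\<bar>sphere_integral r F\<bar> \<le> 2 * pi\<^sup>2 * r\<^sup>2 * B"
proof -
  have "\<bar>F (sphere_point r \<theta> \<phi>) * (r\<^sup>2 * sin \<theta>)\<bar> \<le> B * (r\<^sup>2 * 1)" for \<theta> \<phi>
    unfolding abs_mult using assms norm_sphere_point[OF assms(1)]
    by (intro mult_mono) auto
  then have "\<bar>integral {0..2 * pi} (\<lambda>\<phi>. F (sphere_point r \<theta> \<phi>) * (r\<^sup>2 * sin \<theta>))\<bar>
      \<le> B * (r\<^sup>2 * 1) * (2 * pi - 0)" for \<theta>
    by (rule abs_integral_le[rotated 2]) (use assms in simp_all)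
  then have "\<bar>sphere_integral r F\<bar> \<le> B * (r\<^sup>2 * 1) * (2 * pi - 0) * (pi - 0)"
    unfolding sphere_integral_def by (rule abs_integral_le[rotated 2]) (use assms in simp_all)
  then show ?thesis
    by (simp add: power2_eq_square algebra_simps)
qed

text \<open>The area grows like \<open>r\<^sup>2\<close>, so an integrand of order below
  \<open>- 2\<close> contributes nothing in the limit.\<close>

lemma sphere_integral_tendsto_zero:
  assumes "F \<in> O[at_infinity](\<lambda>x. norm x powr d)" "d < - 2"
  shows "((\<lambda>r. sphere_integral r F) \<longlongrightarrow> 0) at_top"
proof -
  obtain c where c: "c > 0" "\<forall>\<^sub>F x in at_infinity. norm (F x) \<le> c * norm (norm x powr d)"
    using landau_o.bigE[OF assms(1)] by blast
  then obtain b where b: "\<And>x. norm x \<ge> b \<Longrightarrow> \<bar>F x\<bar> \<le> c * norm x powr d"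
    unfolding eventually_at_infinity by auto
  have "\<forall>\<^sub>F r in at_top. norm (sphere_integral r F) \<le> 2 * pi\<^sup>2 * c * r powr (2 + d)"
    using eventually_ge_at_top[of b] eventually_gt_at_top[of 0]
  proof eventually_elim
    case (elim r)
    have "\<bar>sphere_integral r F\<bar> \<le> 2 * pi\<^sup>2 * r\<^sup>2 * (c * r powr d)"
      using elim b c(1) by (intro abs_sphere_integral_le) auto
    also have "\<dots> = 2 * pi\<^sup>2 * c * r powr (2 + d)"
      using elim by (simp add: powr_add)
    finally show ?case
      by simp
  qed
  moreover have "((\<lambda>r. 2 * pi\<^sup>2 * c * r powr (2 + d)) \<longlongrightarrow> 0) at_top"
    using assms(2) by (intro tendsto_mult_right_zero tendsto_neg_powr filterlim_ident) auto
  ultimately show ?thesis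
    by (rule Lim_null_comparison)
qed

text \<open>The integrand is independent of \<open>\<phi>\<close>, and
  \<open>cos \<theta> ^ n * sin \<theta>\<close> has an elementary antiderivative whose boundary
  values cancel for odd \<open>n\<close>.\<close>

lemma sphere_integral_axis_power:
  "sphere_integral r (\<lambda>x. x $ 3 ^ n) = (if even n then 4 * pi * r ^ (n + 2) / (n + 1) else 0)"
proof -
  let ?A = "\<lambda>\<theta>. - (2 * pi * r ^ (n + 2) / (n + 1) * cos \<theta> ^ (n + 1))"
  have "((\<lambda>\<theta>. 2 * pi * ((r * cos \<theta>) ^ n * (r\<^sup>2 * sin \<theta>))) has_integral ?A pi - ?A 0) {0..pi}"
  proof (rule fundamental_theorem_of_calculus)
    fix \<theta> :: real
    have "(?A has_real_derivative
        - (2 * pi * r ^ (n + 2) / (n + 1) * (real (n + 1) * cos \<theta> ^ n * (- sin \<theta>)))) (at \<theta>)"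
      by (rule derivative_eq_intros refl | simp)+
    then have "(?A has_real_derivative 2 * pi * ((r * cos \<theta>) ^ n * (r\<^sup>2 * sin \<theta>))) (at \<theta>)"
      by (simp add: power_mult_distrib power2_eq_square mult_ac del: of_nat_add of_nat_Suc)
    then show "(?A has_vector_derivative 2 * pi * ((r * cos \<theta>) ^ n * (r\<^sup>2 * sin \<theta>)))
        (at \<theta> within {0..pi})"
      by (simp add: has_real_derivative_iff_has_vector_derivative has_vector_derivative_at_within)
  qed auto
  from integral_unique[OF this] have "sphere_integral r (\<lambda>x. x $ 3 ^ n) = ?A pi - ?A 0"
    by (simp only: sphere_integral_def sphere_point_nth integral_const_real) simp
  then show ?thesis
    by auto
qed

text \<open>The first two coordinates are multiples of \<open>cos \<phi>\<close> and
  \<open>sin \<phi>\<close>, while \<open>h\<close> sees only \<open>\<theta>\<close>; so the inner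
  integral vanishes. This settles the off-axis components of momentum and center.\<close>

lemma sphere_integral_off_axis:
  assumes "i \<noteq> 3"
  shows "sphere_integral r (\<lambda>x. h (x $ 3) * x $ i) = 0"
proof -
  have "(cos has_integral (sin (2 * pi) - sin 0)) {0..2 * pi}"
    by (rule fundamental_theorem_of_calculus)
      (auto simp: has_real_derivative_iff_has_vector_derivative[symmetric] intro!: derivative_eq_intros)
  from integral_unique[OF this] have "integral {0..2 * pi} cos = 0"
    by simp
  moreover have "(sin has_integral (- cos (2 * pi) - - cos 0)) {0..2 * pi}"
    by (rule fundamental_theorem_of_calculus)
      (auto simp: has_real_derivative_iff_has_vector_derivative[symmetric] intro!: derivative_eq_intros)
  from integral_unique[OF this] have "integral {0..2 * pi} sin = 0"
    by simp
  ultimately have c: "integral {0..2 * pi} (\<lambda>\<phi>. a * (b * cos \<phi>) * c) = 0"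
      "integral {0..2 * pi} (\<lambda>\<phi>. a * (b * sin \<phi>) * c) = 0" for a b c :: real
    by simp_all
  from assms exhaust_3[of i] consider "i = 1" | "i = 2"
    by blast
  then show ?thesis
    by cases (simp_all only: sphere_integral_def sphere_point_nth c integral_0)
qed

section \<open>Graphs with decaying slope\<close>

text \<open>The Sherman-Morrison formula for a rank-one perturbation of the identity.\<close>

lemma matrix_inv_induced_metric:
  assumes "f differentiable at x" "norm (gradient f x) < 1"
  shows "matrix_inv (induced_metric f x) =
    (\<chi> i j. mat 1 $ i $ j + partial_deriv i f x * partial_deriv j f x / (1 - (norm (gradient f x))\<^sup>2))"
    (is "_ = ?B")
proof (rule matrix_inv_unique)
  let ?n = "(norm (gradient f x))\<^sup>2" and ?p = "\<lambda>i. partial_deriv i f x"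
  let ?A = "induced_metric f x"
  have n: "(\<Sum>k\<in>UNIV. ?p k * ?p k) = ?n"
    by (simp add: power2_norm_eq_inner inner_vec_def gradient_def)
  have pos: "1 - ?n > 0"
    using assms(2) by (simp add: power_less_one_iff)
  define s where "s = 1 / (1 - ?n)"
  have s: "s * (1 - ?n) = 1"
    using pos by (simp add: s_def)
  have 1: "(\<Sum>k\<in>UNIV. (mat 1 $ i $ k - ?p i * ?p k) * (mat 1 $ k $ j + ?p k * ?p j * s))
      = mat 1 $ i $ j" for i j :: 3
  proof -
    have "(\<Sum>k\<in>UNIV. (mat 1 $ i $ k - ?p i * ?p k) * (mat 1 $ k $ j + ?p k * ?p j * s))
        = (\<Sum>k\<in>UNIV. mat 1 $ i $ k * mat 1 $ k $ j + mat 1 $ i $ k * (?p k * ?p j * s)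
            - mat 1 $ k $ j * (?p i * ?p k) - (?p k * ?p k) * (?p i * ?p j * s))"
      by (intro sum.cong) (auto simp: algebra_simps)
    also have "\<dots> = mat 1 $ i $ j + ?p i * ?p j * s - ?p i * ?p j - ?n * (?p i * ?p j * s)"
      by (simp add: sum.distrib sum_subtractf n[symmetric] sum_distrib_right mat_def
          if_distrib[of "\<lambda>a. a * _"] cong: if_cong)
    also have "\<dots> = mat 1 $ i $ j + ?p i * ?p j * (s * (1 - ?n) - 1)"
      by (simp add: algebra_simps)
    finally show ?thesis
      by (simp add: s)
  qed
  have A: "?A $ i $ j = mat 1 $ i $ j - ?p i * ?p j" for i j
    by (simp add: induced_metric_graph[OF assms(1)] mat_def)
  show "?A ** ?B = mat 1"
    using 1 by (simp add: vec_eq_iff matrix_matrix_mult_def A s_def)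
  then show "?B ** ?A = mat 1"
    by (simp add: matrix_left_right_inverse)
qed

text \<open>The radial direction is discontinuous at the origin and hence not a symbol; the flux
  estimates use its boundedness.\<close>

lemma direction_bigo: "(\<lambda>x. x $ j / norm x) \<in> O[at_infinity](\<lambda>x::real^3. norm x powr 0)"
proof (rule bigoI[of _ 1])
  show "\<forall>\<^sub>F x::real^3 in at_infinity. norm (x $ j / norm x) \<le> 1 * norm (norm x powr 0)"
    using eventually_norm_ge[of 1]
  proof eventually_elim
    case (elim x)
    then have "x \<noteq> 0"
      by auto
    then show ?case
      using component_le_norm_cart[of x j] by simp
  qed
qed

lemma symbol_flux_bigo:
  assumes "\<And>j. symbol d (F j)"
  shows "(\<lambda>x. \<Sum>j\<in>UNIV. F j x * (x $ j / norm x)) \<in> O[at_infinity](\<lambda>x. norm x powr d)"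
  using landau_o.big.mult[OF symbol_bigo[OF assms] direction_bigo]
  by (intro big_sum_in_bigo) (simp only: powr_add[symmetric] add_0_right)

lemma continuous_on_flux:
  assumes "\<And>j. symbol d (F j)" "r > 0"
  shows "continuous_on (sphere 0 r) (\<lambda>x. \<Sum>j\<in>UNIV. F j x * (x $ j / norm x))"
  using assms(2)
  by (intro continuous_intros symbol_continuous[OF assms(1)] symbol_continuous[OF symbol_coord]) auto

text \<open>The symmetry hypotheses on the iterated partial derivatives hold for every smooth function;
  assuming them avoids a proof of Schwarz's theorem, and they are immediate from closed formulas.\<close>

locale decaying_graph =
  fixes f :: "real^3 \<Rightarrow> real" and a b :: real
  assumes differentiable_graph: "\<And>x. f differentiable at x"
    and symbol_slope: "\<And>i. symbol (- a) (partial_deriv i f)"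
    and a_gt_half: "a > 1 / 2"
    and b_less_1: "b < 1"
    and gradient_le: "\<And>x. (norm (gradient f x))\<^sup>2 \<le> b"
    and hessian_sym: "\<And>i j x. partial_deriv i (partial_deriv j f) x = partial_deriv j (partial_deriv i f) x"
    and third_sym: "\<And>i j k x. partial_deriv k (partial_deriv i (partial_deriv j f)) x =
      partial_deriv i (partial_deriv k (partial_deriv j f)) x"
begin

lemma norm_gradient_less_1: "norm (gradient f x) < 1"
  using gradient_le[of x] b_less_1 power_less_one_iff[of "norm (gradient f x)" 2] by simp

lemma smooth_graph: "smooth f"
  unfolding smooth_def
proof (intro allI)
  fix "is" x
  show "iter_partial is f differentiable at x"
  \<comment> \<open>\<open>iter_partial\<close> applies the last entry of the list first, so
    splitting it off leaves iterated derivatives of a slope. The graph function itself may grow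
    logarithmically; only its slope is assumed to be a symbol.\<close>
  proof (cases "is" rule: rev_cases)
    case Nil
    then show ?thesis
      by (simp add: iter_partial_def differentiable_graph)
  next
    case (snoc js i)
    then show ?thesis
      using symbol_differentiable[OF symbol_iter_partial[OF symbol_slope]]
      by (simp add: iter_partial_def)
  qed
qed

lemma spacelike: "spacelike_graph f"
  by (simp add: spacelike_graph_iff[OF differentiable_graph] norm_gradient_less_1)

lemma symbol_hessian: "symbol (- a - 1) (partial_deriv i (partial_deriv j f))"
  by (rule symbol_partial[OF symbol_slope])

text \<open>The excess over 1 of the time component of the unit normal. It decays twice as fast as
  the slope bound, so the second fundamental form is the Hessian plus a faster decaying
  term.\<close>

definition tilt :: "real^3 \<Rightarrow> real" where
  "tilt x = 1 / sqrt (1 - (norm (gradient f x))\<^sup>2) - 1"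

lemma symbol_tilt: "symbol (- 2 * a) tilt"
  unfolding tilt_def[abs_def]
proof (rule symbol_inverse_sqrt[OF _ _ b_less_1 gradient_le])
  have "symbol (- 2 * a) (\<lambda>x. \<Sum>i\<in>UNIV. partial_deriv i f x * partial_deriv i f x)"
    by (intro symbol_sum symbol_mult[OF symbol_slope symbol_slope]) simp
  then show "symbol (- 2 * a) (\<lambda>x. (norm (gradient f x))\<^sup>2)"
    by (simp add: power2_norm_eq_inner inner_vec_def gradient_def)
qed (use a_gt_half in simp)

lemma metric_deviation_graph:
  "metric_deviation (induced_metric f) x $ i $ j = - (partial_deriv i f x * partial_deriv j f x)"
  by (simp add: metric_deviation_def induced_metric_graph[OF differentiable_graph] mat_def)

lemma inverse_deviation_graph:
  "(matrix_inv (induced_metric f x) - mat 1) $ i $ j =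
    (1 + tilt x)\<^sup>2 * (partial_deriv i f x * partial_deriv j f x)"
proof -
  have "1 - (norm (gradient f x))\<^sup>2 > 0"
    using gradient_le[of x] b_less_1 by linarith
  then show ?thesis
    by (simp add: matrix_inv_induced_metric[OF differentiable_graph norm_gradient_less_1]
        tilt_def power_divide)
qed

sublocale decaying_metric "induced_metric f" "2 * a"
proof
  show "0 \<le> 2 * a"
    using a_gt_half by simp
  fix i j
  have s: "symbol (- (2 * a)) (\<lambda>x. partial_deriv i f x * partial_deriv j f x)"
    by (rule symbol_mult[OF symbol_slope symbol_slope]) simp
  then show "symbol (- (2 * a)) (\<lambda>x. metric_deviation (induced_metric f) x $ i $ j)"
    by (simp add: metric_deviation_graph symbol_minus)
  have "symbol 0 (\<lambda>x. 1 + tilt x)"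
    using a_gt_half by (intro symbol_add symbol_const symbol_mono[OF symbol_tilt]) simp
  from symbol_mult[OF symbol_power[OF this, of 2] s, of "- (2 * a)"]
  show "symbol (- (2 * a)) (\<lambda>x. (matrix_inv (induced_metric f x) - mat 1) $ i $ j)"
    unfolding inverse_deviation_graph by simp
qed

abbreviation "gbar \<equiv> induced_metric f"
abbreviation "kbar \<equiv> second_fundamental_form f"

lemma second_fundamental_form_tilt:
  "kbar x $ i $ j = partial_deriv i (partial_deriv j f) x + tilt x * partial_deriv i (partial_deriv j f) x"
  by (simp add: second_fundamental_form_graph[OF smooth_graph] tilt_def algebra_simps)

lemma symbol_tilt_hessian:
  "symbol (- 3 * a - 1) (\<lambda>x. tilt x * partial_deriv i (partial_deriv j f) x)"
  by (rule symbol_mult[OF symbol_tilt symbol_hessian]) simp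

lemma symbol_second_fundamental_form: "symbol (- a - 1) (\<lambda>x. kbar x $ i $ j)"
  unfolding second_fundamental_form_tilt
  using a_gt_half by (intro symbol_add symbol_hessian symbol_mono[OF symbol_tilt_hessian]) simp

text \<open>The terms linear in \<open>f\<close> would only have order \<open>- a - 2\<close>, which
  for \<open>a = 1\<close> is the excluded borderline \<open>- 3\<close>. After they cancel, every
  remaining term carries the tilt or a metric deviation and gains \<open>2 * a\<close>
  orders.\<close>

lemma symbol_momentum_density: "symbol (- 3 * a - 2) (\<lambda>x. momentum_density gbar kbar x $ i)"
proof -
  let ?L = "\<lambda>i j x. tilt x * partial_deriv i (partial_deriv j f) x"
  have k: "partial_deriv l (\<lambda>y. kbar y $ i $ j) x =
      partial_deriv l (partial_deriv i (partial_deriv j f)) x + partial_deriv l (?L i j) x" for l i j x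
    unfolding second_fundamental_form_tilt
    by (rule partial_deriv_add[OF symbol_differentiable[OF symbol_hessian]
          symbol_differentiable[OF symbol_tilt_hessian]])
  have third: "partial_deriv j (partial_deriv i (partial_deriv j f)) x
      = partial_deriv i (partial_deriv j (partial_deriv j f)) x" for j x
    by (rule third_sym)
  have "momentum_density gbar kbar x $ i =
      (momentum_density gbar kbar x $ i -
        (\<Sum>j\<in>UNIV. partial_deriv j (\<lambda>y. kbar y $ i $ j) x - partial_deriv i (\<lambda>y. kbar y $ j $ j) x))
      + (\<Sum>j\<in>UNIV. partial_deriv j (?L i j) x - partial_deriv i (?L j j) x)" for x
    by (simp add: k third)
  moreover have "symbol (- 3 * a - 2) (\<lambda>x.
      (momentum_density gbar kbar x $ i -
        (\<Sum>j\<in>UNIV. partial_deriv j (\<lambda>y. kbar y $ i $ j) x - partial_deriv i (\<lambda>y. kbar y $ j $ j) x))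
      + (\<Sum>j\<in>UNIV. partial_deriv j (?L i j) x - partial_deriv i (?L j j) x))"
  proof (rule symbol_add)
    show "symbol (- 3 * a - 2) (\<lambda>x. momentum_density gbar kbar x $ i -
        (\<Sum>j\<in>UNIV. partial_deriv j (\<lambda>y. kbar y $ i $ j) x - partial_deriv i (\<lambda>y. kbar y $ j $ j) x))"
      by (rule symbol_mono[OF symbol_momentum_density_deviation[OF symbol_second_fundamental_form]]) simp
    show "symbol (- 3 * a - 2) (\<lambda>x. \<Sum>j\<in>UNIV. partial_deriv j (?L i j) x - partial_deriv i (?L j j) x)"
      by (intro symbol_sum symbol_diff symbol_mono[OF symbol_partial[OF symbol_tilt_hessian]]) auto
  qed
  ultimately show ?thesis
    by simp
qed

lemma asymptotically_flat_graph: "asymptotically_flat gbar kbar"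
  unfolding asymptotically_flat_def
proof (intro exI conjI allI)
  \<comment> \<open>The exponents are \<open>q = 2 * a\<close>, \<open>p = a + 1\<close> and
    \<open>\<epsilon> = 2 * a - 1\<close>; the last makes \<open>- 3 - \<epsilon>\<close> equal to
    \<open>- 2 * a - 2\<close>, the order of the energy density.\<close>
  show "2 * a > 1 / 2" "a + 1 > 3 / 2" "2 * a - 1 > 0"
    using a_gt_half by auto
  show "O_deriv 2 (- (2 * a)) (\<lambda>x. metric_deviation gbar x $ i $ j)" for i j
    by (rule symbol_O_deriv[OF symbol_deviation])
  show "O_deriv 1 (- (a + 1)) (\<lambda>x. kbar x $ i $ j)" for i j
    by (rule symbol_O_deriv[OF symbol_mono[OF symbol_second_fundamental_form]]) simp
  show "energy_density gbar kbar \<in> O[at_infinity](\<lambda>x. norm x powr (- 3 - (2 * a - 1)))"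
    by (rule symbol_bigo[OF symbol_energy_density[OF symbol_second_fundamental_form]]) auto
  show "covector_norm gbar (momentum_density gbar kbar)
      \<in> O[at_infinity](\<lambda>x. norm x powr (- 3 - (2 * a - 1)))"
    using a_gt_half by (intro covector_norm_bigo symbol_mono[OF symbol_momentum_density]) auto
qed

section \<open>ADM energy and momentum of a decaying graph\<close>

lemma energy_flux_graph:
  "energy_flux gbar x = ((\<Sum>k\<in>UNIV. partial_deriv k f x * (\<Sum>j\<in>UNIV. partial_deriv j (partial_deriv k f) x * x $ j))
    - (\<Sum>j\<in>UNIV. partial_deriv j f x * x $ j) * (\<Sum>k\<in>UNIV. partial_deriv k (partial_deriv k f) x)) / norm x"
proof -
  have p: "partial_deriv k (\<lambda>y. gbar y $ i $ j) x =
      - (partial_deriv k (partial_deriv i f) x * partial_deriv j f x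
        + partial_deriv i f x * partial_deriv k (partial_deriv j f) x)" for i j k
  proof -
    have "partial_deriv k (\<lambda>y. gbar y $ i $ j) x
        = partial_deriv k (\<lambda>y. (if i = j then 1 else 0) - partial_deriv i f y * partial_deriv j f y) x"
      by (simp add: induced_metric_graph[OF differentiable_graph])
    then show ?thesis
      using symbol_differentiable[OF symbol_slope]
      by (simp add: partial_deriv_diff partial_deriv_const partial_deriv_mult)
  qed
  \<comment> \<open>The product of a slope with a mixed second derivative occurs once in the first
    metric derivative and twice, with opposite sign, in the second; symmetry of the Hessian leaves
    one copy.\<close>
  have "energy_flux gbar x = (\<Sum>j\<in>UNIV. \<Sum>k\<in>UNIV.
      (partial_deriv k f x * (partial_deriv j (partial_deriv k f) x * x $ j)
       - (partial_deriv j f x * x $ j) * partial_deriv k (partial_deriv k f) x) / norm x)"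
    unfolding energy_flux_def p
  proof (intro sum.cong refl)
    fix j k
    show "(- (partial_deriv k (partial_deriv j f) x * partial_deriv k f x
          + partial_deriv j f x * partial_deriv k (partial_deriv k f) x)
        - - (partial_deriv j (partial_deriv k f) x * partial_deriv k f x
          + partial_deriv k f x * partial_deriv j (partial_deriv k f) x)) * (x $ j / norm x)
      = (partial_deriv k f x * (partial_deriv j (partial_deriv k f) x * x $ j)
       - (partial_deriv j f x * x $ j) * partial_deriv k (partial_deriv k f) x) / norm x"
      unfolding hessian_sym[of k j] by (cases "x = 0") (simp_all add: field_simps)
  qed
  also have "\<dots> = ((\<Sum>j\<in>UNIV. \<Sum>k\<in>UNIV. partial_deriv k f x * (partial_deriv j (partial_deriv k f) x * x $ j))
      - (\<Sum>j\<in>UNIV. \<Sum>k\<in>UNIV. (partial_deriv j f x * x $ j) * partial_deriv k (partial_deriv k f) x)) / norm x"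
    by (simp only: sum_divide_distrib[symmetric] sum_subtractf)
  finally show ?thesis
    by (subst (asm) sum.swap) (simp only: sum_distrib_left[symmetric] sum_distrib_right[symmetric])
qed

text \<open>The metric deviation is quadratic in the slope, which puts the flux at order
  \<open>- 2 * a - 1 < - 2\<close>.\<close>

lemma ADM_energy_zero: "has_ADM_energy gbar 0"
proof -
  let ?F = "\<lambda>j x. \<Sum>k\<in>UNIV. partial_deriv k (\<lambda>y. gbar y $ j $ k) x - partial_deriv j (\<lambda>y. gbar y $ k $ k) x"
  have eq: "energy_flux gbar = (\<lambda>x. \<Sum>j\<in>UNIV. ?F j x * (x $ j / norm x))"
    unfolding energy_flux_def[abs_def] sum_distrib_right ..
  have "energy_flux gbar \<in> O[at_infinity](\<lambda>x. norm x powr (- (2 * a) - 1))"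
    unfolding eq by (intro symbol_flux_bigo symbol_sum symbol_diff symbol_partial_metric)
  from tendsto_mult_right_zero[OF sphere_integral_tendsto_zero[OF this], of "1 / (16 * pi)"]
  show ?thesis
    using a_gt_half by (simp add: has_ADM_energy_def)
qed

text \<open>Only the part of the flux that is linear in \<open>f\<close> survives in the limit.\<close>

lemma ADM_momentum_zero:
  assumes "\<And>i. ((\<lambda>r. sphere_integral r (\<lambda>x. \<Sum>j\<in>UNIV. (partial_deriv i (partial_deriv j f) x
      - mat 1 $ i $ j * (\<Sum>l\<in>UNIV. partial_deriv l (partial_deriv l f) x)) * (x $ j / norm x)))
      \<longlongrightarrow> 0) at_top"
  shows "has_ADM_momentum gbar kbar 0"
  unfolding has_ADM_momentum_def
proof
  fix i
  let ?L = "\<lambda>j x. partial_deriv i (partial_deriv j f) x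
      - mat 1 $ i $ j * (\<Sum>l\<in>UNIV. partial_deriv l (partial_deriv l f) x)"
  let ?Q = "\<lambda>j x. conjugate_momentum gbar kbar x $ i $ j - ?L j x"
  let ?I = "\<lambda>F x. \<Sum>j\<in>UNIV. F j x * (x $ j / norm x)"
  have L: "symbol (- a - 1) (?L j)" for j
    by (intro symbol_diff symbol_cmult symbol_sum symbol_hessian)
  have Q: "symbol (- 3 * a - 1) (?Q j)" for j
  proof -
    \<comment> \<open>The four corrections come from the tilt in \<open>kbar\<close>, the deviation
      of \<open>gbar\<close> from the identity, the deviation of the metric trace from the Euclidean
      one, and the tilt in the latter. Each has order at most
      \<open>- 3 * a - 1 < - 2\<close>.\<close>
    have "?Q j x = tilt x * partial_deriv i (partial_deriv j f) x
        - metric_trace gbar kbar x * metric_deviation gbar x $ i $ j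
        - mat 1 $ i $ j * (metric_trace gbar kbar x - (\<Sum>l\<in>UNIV. kbar x $ l $ l))
        - mat 1 $ i $ j * (\<Sum>l\<in>UNIV. tilt x * partial_deriv l (partial_deriv l f) x)" for x
      unfolding conjugate_momentum_def metric_deviation_def second_fundamental_form_tilt
        vector_minus_component vector_scaleR_component real_scaleR_def sum.distrib
      by (simp add: algebra_simps)
    moreover have "symbol (- 3 * a - 1) (\<lambda>x. tilt x * partial_deriv i (partial_deriv j f) x
        - metric_trace gbar kbar x * metric_deviation gbar x $ i $ j
        - mat 1 $ i $ j * (metric_trace gbar kbar x - (\<Sum>l\<in>UNIV. kbar x $ l $ l))
        - mat 1 $ i $ j * (\<Sum>l\<in>UNIV. tilt x * partial_deriv l (partial_deriv l f) x))"
      by (intro symbol_diff symbol_cmult symbol_sum symbol_tilt_hessian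
          symbol_mult[OF symbol_metric_trace[OF symbol_second_fundamental_form] symbol_deviation]
          symbol_mono[OF symbol_metric_trace_deviation[OF symbol_second_fundamental_form]]) auto
    ultimately show ?thesis
      by simp
  qed
  have Q0: "((\<lambda>r. sphere_integral r (?I ?Q)) \<longlongrightarrow> 0) at_top"
    using a_gt_half by (intro sphere_integral_tendsto_zero[OF symbol_flux_bigo[OF Q]]) auto
  have "\<forall>\<^sub>F r in at_top. sphere_integral r (?I ?L) + sphere_integral r (?I ?Q) =
      sphere_integral r (\<lambda>x. \<Sum>j\<in>UNIV. conjugate_momentum gbar kbar x $ i $ j * (x $ j / norm x))"
    using eventually_gt_at_top[of 0]
  proof eventually_elim
    case (elim r)
    have "sphere_integral r (?I ?L) + sphere_integral r (?I ?Q) =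
        sphere_integral r (\<lambda>x. ?I ?L x + ?I ?Q x)"
      using elim by (intro sphere_integral_add[symmetric] continuous_on_flux[OF L]
          continuous_on_flux[OF Q]) auto
    also have "(\<lambda>x. ?I ?L x + ?I ?Q x) =
        (\<lambda>x. \<Sum>j\<in>UNIV. conjugate_momentum gbar kbar x $ i $ j * (x $ j / norm x))"
      unfolding sum.distrib[symmetric] distrib_right[symmetric] by simp
    finally show ?case .
  qed
  from Lim_transform_eventually[OF tendsto_add[OF assms[of i] Q0] this]
  have "((\<lambda>r. sphere_integral r (\<lambda>x. \<Sum>j\<in>UNIV.
      conjugate_momentum gbar kbar x $ i $ j * (x $ j / norm x))) \<longlongrightarrow> 0) at_top"
    by simp
  from tendsto_mult_right_zero[OF this, of "1 / (8 * pi)"]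
  show "((\<lambda>r. 1 / (8 * pi) * sphere_integral r (\<lambda>x. \<Sum>j\<in>UNIV.
      conjugate_momentum gbar kbar x $ i $ j * (x $ j / norm x))) \<longlongrightarrow> (0 :: real^3) $ i) at_top"
    by simp
qed

end

section \<open>The example\<close>

lemma differentiable_coord: "(\<lambda>x::real^'n. x $ i) differentiable at x"
  using bounded_linear_imp_differentiable[OF bounded_linear_vec_nth] .

lemma partial_deriv_power:
  fixes F :: "real^3 \<Rightarrow> real"
  assumes "F differentiable at x"
  shows "partial_deriv i (\<lambda>x. F x ^ n) x = real n * F x ^ (n - 1) * partial_deriv i F x"
  by (rule partial_deriv_chain(2)[OF assms]) (auto intro!: derivative_eq_intros)

lemmas partial_deriv_simps =
  partial_deriv_const partial_deriv_coord partial_deriv_inv_bracket partial_deriv_add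
  partial_deriv_diff partial_deriv_mult partial_deriv_power
  differentiable_coord differentiable_inv_bracket differentiable_const differentiable_add
  differentiable_diff differentiable_mult differentiable_power

text \<open>The factor \<open>1 / 4\<close> keeps the slope at most \<open>3 / 4\<close>, hence the
  graph spacelike. The slopes of the even and the odd part both decay like \<open>1 / r\<close>, so
  their product reaches the critical order.\<close>

definition profile :: "real^3 \<Rightarrow> real" where
  "profile x = 1 / 4 * (1 / 2 * ln (1 + x \<bullet> x) + x $ 3 * inv_bracket x)"

text \<open>Slope and Hessian are kept as polynomials in \<open>inv_bracket\<close> and the
  coordinates, which turns the symmetry of second and third derivatives into algebra.\<close>

definition profile_slope :: "3 \<Rightarrow> real^3 \<Rightarrow> real" where
  "profile_slope i x = 1 / 4 * ((inv_bracket x ^ 2 - x $ 3 * inv_bracket x ^ 3) * x $ i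
     + (if i = 3 then 1 else 0) * inv_bracket x)"

definition profile_hessian :: "3 \<Rightarrow> 3 \<Rightarrow> real^3 \<Rightarrow> real" where
  "profile_hessian i j x = 1 / 4 *
     ((if i = j then 1 else 0) * (inv_bracket x ^ 2 - x $ 3 * inv_bracket x ^ 3)
      + (3 * x $ 3 * inv_bracket x ^ 5 - 2 * inv_bracket x ^ 4) * (x $ i * x $ j)
      - inv_bracket x ^ 3 * ((if j = 3 then 1 else 0) * x $ i + (if i = 3 then 1 else 0) * x $ j))"

lemma
  shows differentiable_profile: "profile differentiable at x"
    and partial_deriv_profile: "partial_deriv i profile = profile_slope i"
proof -
  have h: "(\<lambda>x. ln (1 + x \<bullet> x)) differentiable at x"
    "partial_deriv i (\<lambda>x. ln (1 + x \<bullet> x)) x = inv_bracket x ^ 2 * (2 * x $ i)" for x :: "real^3"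
  proof -
    have "1 + x \<bullet> x > 0"
      by (rule add_pos_nonneg) auto
    moreover from this have "1 / (1 + x \<bullet> x) = inv_bracket x ^ 2"
      using inv_bracket_sq[of x] by (simp add: field_simps)
    ultimately have d: "((\<lambda>y. ln (1 + y)) has_real_derivative inv_bracket x ^ 2) (at (x \<bullet> x))"
      by (auto intro!: derivative_eq_intros)
    show "(\<lambda>x. ln (1 + x \<bullet> x)) differentiable at x"
      "partial_deriv i (\<lambda>x. ln (1 + x \<bullet> x)) x = inv_bracket x ^ 2 * (2 * x $ i)"
      using partial_deriv_chain[OF differentiable_dot_self d] by (simp_all add: partial_deriv_dot_self)
  qed
  show "profile differentiable at x"
    unfolding profile_def[abs_def]
    by (intro differentiable_mult differentiable_add differentiable_const h differentiable_coord
        differentiable_inv_bracket)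
  show "partial_deriv i profile = profile_slope i"
    unfolding profile_def[abs_def] profile_slope_def[abs_def]
    by (rule ext) (simp only: partial_deriv_simps h, simp add: algebra_simps)
qed

lemma partial_deriv_profile_slope: "partial_deriv i (profile_slope j) = profile_hessian i j"
  unfolding profile_slope_def[abs_def] profile_hessian_def[abs_def]
  by (rule ext) (simp only: partial_deriv_simps, simp add: algebra_simps power_numeral_reduce)

lemma profile_hessian_sym: "profile_hessian i j x = profile_hessian j i x"
  by (simp add: profile_hessian_def algebra_simps)

lemma partial_deriv_profile_hessian_sym:
  "partial_deriv k (profile_hessian i j) x = partial_deriv i (profile_hessian k j) x"
  unfolding profile_hessian_def[abs_def]
  by (simp only: partial_deriv_simps, simp add: algebra_simps power_numeral_reduce)

lemma symbol_profile_slope: "symbol (- 1) (profile_slope i)"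
proof -
  have "symbol (- 2) (\<lambda>x. inv_bracket x ^ 2 - x $ 3 * inv_bracket x ^ 3)"
    by (intro symbol_diff symbol_mono[OF symbol_power[OF symbol_inv_bracket]]
        symbol_mult[OF symbol_coord symbol_power[OF symbol_inv_bracket]]) auto
  then show ?thesis
    unfolding profile_slope_def[abs_def]
    by (intro symbol_cmult symbol_add symbol_inv_bracket symbol_mult[OF _ symbol_coord]) auto
qed

text \<open>Up to the factor \<open>1 / 4\<close>, the gradient is a multiple of \<open>x\<close> of
  length at most 2 plus an axis vector of length at most 1, by
  \<open>inv_bracket x * norm x \<le> 1\<close> and \<open>inv_bracket x \<le> 1\<close>.\<close>

lemma norm_gradient_profile: "norm (gradient profile x) \<le> 3 / 4"
proof -
  let ?v = "inv_bracket x" and ?z = "x $ 3"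
  have z: "?v * \<bar>?z\<bar> \<le> 1"
    using inv_bracket_mult_norm[of x] inv_bracket_pos[of x] component_le_norm_cart[of x 3]
    by (meson less_imp_le mult_left_mono order_trans)
  have "gradient profile x = (1 / 4) *\<^sub>R ((?v * (1 - ?v * ?z) * ?v) *\<^sub>R x + ?v *\<^sub>R axis 3 1)"
    by (simp add: vec_eq_iff gradient_def partial_deriv_profile profile_slope_def axis_def
        algebra_simps power_numeral_reduce)
  also have "norm \<dots> \<le> 1 / 4 * (norm ((?v * (1 - ?v * ?z) * ?v) *\<^sub>R x) + norm (?v *\<^sub>R axis 3 1 :: real^3))"
    using norm_triangle_ineq[of "(?v * (1 - ?v * ?z) * ?v) *\<^sub>R x" "?v *\<^sub>R axis 3 1"] by simp
  also have "norm ((?v * (1 - ?v * ?z) * ?v) *\<^sub>R x) = (?v * \<bar>1 - ?v * ?z\<bar>) * (?v * norm x)"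
    using inv_bracket_pos[of x] by (simp add: abs_mult)
  also have "(?v * \<bar>1 - ?v * ?z\<bar>) * (?v * norm x) \<le> (1 * 2) * 1"
  proof (intro mult_mono inv_bracket_le_1 inv_bracket_mult_norm)
    have "\<bar>?v * ?z\<bar> \<le> 1"
      using z inv_bracket_pos[of x] by (simp add: abs_mult)
    then show "\<bar>1 - ?v * ?z\<bar> \<le> 2"
      by linarith
  qed (use inv_bracket_pos[of x] in auto)
  also have "norm (?v *\<^sub>R axis 3 1 :: real^3) \<le> 1"
    using inv_bracket_le_1[of x] inv_bracket_pos[of x] by simp
  finally show ?thesis
    by simp
qed

text \<open>The slope has order \<open>- 1\<close>, and \<open>9 / 16\<close> is the square of the
  slope bound \<open>3 / 4\<close>.\<close>

interpretation profile: decaying_graph profile 1 "9 / 16"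
proof
  show "symbol (- 1) (partial_deriv i profile)" for i
    by (simp add: partial_deriv_profile symbol_profile_slope)
  show "(norm (gradient profile x))\<^sup>2 \<le> 9 / 16" for x
    using power_mono[OF norm_gradient_profile, of x 2] by (simp add: power_divide)
  show "partial_deriv i (partial_deriv j profile) x = partial_deriv j (partial_deriv i profile) x" for i j x
    by (simp add: partial_deriv_profile partial_deriv_profile_slope profile_hessian_sym)
  show "partial_deriv k (partial_deriv i (partial_deriv j profile)) x =
      partial_deriv i (partial_deriv k (partial_deriv j profile)) x" for i j k x
    by (simp add: partial_deriv_profile partial_deriv_profile_slope partial_deriv_profile_hessian_sym)
qed (auto simp: differentiable_profile)

section \<open>Contractions of the profile's derivatives, and their integrals over spheres\<close>

lemma norm_sq_3: "(norm (x :: real^3))\<^sup>2 = x $ 1 * x $ 1 + x $ 2 * x $ 2 + x $ 3 * x $ 3"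
  by (simp add: power2_norm_eq_inner inner_vec_def sum_3)

lemma sum_hessian_radial:
  "(\<Sum>j\<in>UNIV. profile_hessian j k x * x $ j) = 1 / 4 *
    ((inv_bracket x ^ 2 - x $ 3 * inv_bracket x ^ 3
      + (3 * x $ 3 * inv_bracket x ^ 5 - 2 * inv_bracket x ^ 4) * (norm x)\<^sup>2
      - inv_bracket x ^ 3 * x $ 3) * x $ k - (if k = 3 then 1 else 0) * inv_bracket x ^ 3 * (norm x)\<^sup>2)"
  using exhaust_3[of k] unfolding norm_sq_3 sum_3 profile_hessian_def
  by (elim disjE) (simp_all add: algebra_simps)

lemma laplacian_profile:
  "(\<Sum>k\<in>UNIV. profile_hessian k k x) = 1 / 4 *
    (3 * (inv_bracket x ^ 2 - x $ 3 * inv_bracket x ^ 3)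
      + (3 * x $ 3 * inv_bracket x ^ 5 - 2 * inv_bracket x ^ 4) * (norm x)\<^sup>2
      - 2 * inv_bracket x ^ 3 * x $ 3)"
  unfolding norm_sq_3 sum_3 profile_hessian_def by (simp add: algebra_simps)

lemma sum_slope_radial:
  "(\<Sum>j\<in>UNIV. profile_slope j x * x $ j) = 1 / 4 *
    ((inv_bracket x ^ 2 - x $ 3 * inv_bracket x ^ 3) * (norm x)\<^sup>2 + inv_bracket x * x $ 3)"
  unfolding norm_sq_3 sum_3 profile_slope_def by (simp add: algebra_simps)

lemma sum_slope_sq:
  "(\<Sum>j\<in>UNIV. profile_slope j x * profile_slope j x) = 1 / 16 *
    ((inv_bracket x ^ 2 - x $ 3 * inv_bracket x ^ 3)\<^sup>2 * (norm x)\<^sup>2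
      + 2 * (inv_bracket x ^ 2 - x $ 3 * inv_bracket x ^ 3) * inv_bracket x * x $ 3 + inv_bracket x ^ 2)"
  unfolding norm_sq_3 sum_3 profile_slope_def by (simp add: algebra_simps power2_eq_square)

text \<open>As \<open>inv_bracket\<close> is constant on each sphere, the integrands there become
  polynomials in the coordinates.\<close>

lemma inv_bracket_norm: "norm x = r \<Longrightarrow> inv_bracket x = 1 / sqrt (1 + r\<^sup>2)"
  by (simp add: inv_bracket_def power2_norm_eq_inner flip: power2_norm_eq_inner)

text \<open>Odd powers of \<open>x $ 3\<close> cancel by reflection, and \<open>x $ 3 ^ 2\<close>
  has average \<open>r\<^sup>2 / 3\<close>.\<close>

lemma sphere_integral_cubic:
  assumes "r \<ge> 0"
  shows "sphere_integral r (\<lambda>x. c0 + c1 * x $ 3 + c2 * x $ 3 ^ 2 + c3 * x $ 3 ^ 3) =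
    4 * pi * r\<^sup>2 * c0 + 4 * pi / 3 * r ^ 4 * c2"
proof -
  have "continuous_on (sphere 0 r) (\<lambda>x::real^3. x $ 3)"
    by (rule symbol_continuous[OF symbol_coord])
  then have "sphere_integral r (\<lambda>x. c0 * x $ 3 ^ 0 + c1 * x $ 3 ^ 1 + c2 * x $ 3 ^ 2 + c3 * x $ 3 ^ 3) =
      c0 * sphere_integral r (\<lambda>x. x $ 3 ^ 0) + c1 * sphere_integral r (\<lambda>x. x $ 3 ^ 1)
      + c2 * sphere_integral r (\<lambda>x. x $ 3 ^ 2) + c3 * sphere_integral r (\<lambda>x. x $ 3 ^ 3)"
    using assms
    by (simp only: sphere_integral_add sphere_integral_cmult continuous_on_add continuous_on_mult
        continuous_on_const continuous_on_power)
  then show ?thesis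
    unfolding sphere_integral_axis_power by (simp add: power_numeral_reduce)
qed

text \<open>The linear part of the flux is evaluated directly; its integral vanishes at every
  radius, not only in the limit.\<close>

lemma profile_momentum_zero: "has_ADM_momentum (induced_metric profile) (second_fundamental_form profile) 0"
proof (rule profile.ADM_momentum_zero)
  fix i :: 3
  let ?F = "\<lambda>x. \<Sum>j\<in>UNIV. (partial_deriv i (partial_deriv j profile) x
      - mat 1 $ i $ j * (\<Sum>l\<in>UNIV. partial_deriv l (partial_deriv l profile) x)) * (x $ j / norm x)"
  have "sphere_integral r ?F = 0" if r: "r > 0" for r
  proof -
    define v where "v = 1 / sqrt (1 + r\<^sup>2)"
    define h where "h z = 1 / (4 * r) * (3 * v ^ 3 * z - 2 * v\<^sup>2)" for z
    have F: "?F x = h (x $ 3) * x $ i - (if i = 3 then 1 else 0) * (1 / (4 * r) * v ^ 3 * r\<^sup>2)"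
      if x: "norm x = r" for x
    proof -
      have "profile_hessian i = (\<lambda>j. profile_hessian j i)"
        using profile_hessian_sym by blast
      then have "?F x = ((\<Sum>j\<in>UNIV. profile_hessian j i x * x $ j)
          - (\<Sum>l\<in>UNIV. profile_hessian l l x) * x $ i) / r"
        using r unfolding x partial_deriv_profile partial_deriv_profile_slope
        by (simp add: sum_subtractf left_diff_distrib mat_def if_distrib[of "\<lambda>a. a * _"]
            flip: sum_divide_distrib cong: if_cong)
      then show ?thesis
        using r unfolding sum_hessian_radial laplacian_profile inv_bracket_norm[OF x, folded v_def] x h_def
        by (simp add: field_simps power_numeral_reduce)
    qed
    show ?thesis
    proof (cases "i = 3")
      case True
      \<comment> \<open>The constant term contributes \<open>- pi * r ^ 3 * v ^ 3\<close> and the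
        quadratic one \<open>pi * r ^ 3 * v ^ 3\<close>.\<close>
      have "sphere_integral r ?F = sphere_integral r (\<lambda>x. - (1 / (4 * r) * v ^ 3 * r\<^sup>2)
          + (- 1 / (4 * r) * (2 * v\<^sup>2)) * x $ 3 + (1 / (4 * r) * (3 * v ^ 3)) * x $ 3 ^ 2 + 0 * x $ 3 ^ 3)"
        by (rule sphere_integral_cong)
          (use r in simp, subst F, assumption, simp add: h_def True algebra_simps power2_eq_square)
      then show ?thesis
        using r unfolding sphere_integral_cubic[OF less_imp_le[OF r]]
        by (simp add: field_simps power_numeral_reduce)
    next
      case False
      then have "sphere_integral r ?F = sphere_integral r (\<lambda>x. h (x $ 3) * x $ i)"
        by (intro sphere_integral_cong) (use r in simp, subst F, assumption, simp)
      then show ?thesis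
        using sphere_integral_off_axis[OF False] by simp
    qed
  qed
  then have "\<forall>\<^sub>F r in at_top. 0 = sphere_integral r ?F"
    using eventually_mono[OF eventually_gt_at_top[of "0::real"]] by fastforce
  then show "((\<lambda>r. sphere_integral r ?F) \<longlongrightarrow> 0) at_top"
    by (rule Lim_transform_eventually[OF tendsto_const])
qed

text \<open>The integral for the third component is computed exactly as
  \<open>pi / 3 * (r / sqrt (1 + r\<^sup>2)) ^ 5\<close>. It tends to \<open>pi / 3\<close>, and
  dividing by \<open>16 * pi\<close> gives \<open>1 / 48\<close>.\<close>

lemma profile_center: "has_BORT_center (induced_metric profile) ((1 / 48) *\<^sub>R axis 3 1)"
  unfolding has_BORT_center_def
proof
  fix i :: 3
  let ?g = "induced_metric profile"
  let ?F = "\<lambda>x. x $ i * energy_flux ?g x - (\<Sum>k\<in>UNIV. metric_deviation ?g x $ k $ i * (x $ k / norm x)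
      - metric_deviation ?g x $ k $ k * (x $ i / norm x))"
  have I: "sphere_integral r ?F = (if i = 3 then pi / 3 * (r / sqrt (1 + r\<^sup>2)) ^ 5 else 0)"
    if r: "r > 0" for r
  proof -
    define v where "v = 1 / sqrt (1 + r\<^sup>2)"
    \<comment> \<open>With \<open>z = x $ 3\<close>, \<open>A\<close> is the coefficient of
      \<open>x $ i\<close> in four times the slope, \<open>S\<close> four times the radial
      contraction of the slope, and \<open>T\<close> sixteen times the numerator of the energy flux;
      \<open>h\<close> collects all that multiplies \<open>x $ i\<close>.\<close>
    define A where "A z = v\<^sup>2 - z * v ^ 3" for z
    define S where "S z = A z * r\<^sup>2 + v * z" for z
    define T where "T z = S z * (v ^ 3 * z - 2 * A z) - v ^ 3 * r\<^sup>2 * (A z * z + v)" for z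
    define h where "h z = 1 / (16 * r) * (T z - A z * v * z - v\<^sup>2)" for z
    have F: "?F x = h (x $ 3) * x $ i + (if i = 3 then 1 else 0) * (1 / (16 * r) * v * S (x $ 3))"
      if x: "norm x = r" for x
    proof -
      note v = inv_bracket_norm[OF x, folded v_def]
      let ?s = "\<lambda>j. profile_slope j x"
      have slope: "(\<Sum>j\<in>UNIV. ?s j * x $ j) = 1 / 4 * S (x $ 3)"
        unfolding sum_slope_radial v x S_def A_def by simp
      have lap: "(\<Sum>k\<in>UNIV. profile_hessian k k x) = 1 / 4 *
          (3 * A (x $ 3) + (3 * x $ 3 * v ^ 5 - 2 * v ^ 4) * r\<^sup>2 - 2 * v ^ 3 * x $ 3)"
        unfolding laplacian_profile v x A_def by simp
      have hess: "(\<Sum>k\<in>UNIV. ?s k * (\<Sum>j\<in>UNIV. profile_hessian j k x * x $ j)) = 1 / 16 *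
          ((A (x $ 3) + (3 * x $ 3 * v ^ 5 - 2 * v ^ 4) * r\<^sup>2 - v ^ 3 * x $ 3) * S (x $ 3)
            - v ^ 3 * r\<^sup>2 * (A (x $ 3) * x $ 3 + v))"
      proof -
        define c where "c = A (x $ 3) + (3 * x $ 3 * v ^ 5 - 2 * v ^ 4) * r\<^sup>2 - v ^ 3 * x $ 3"
        have "(\<Sum>k\<in>UNIV. ?s k * (\<Sum>j\<in>UNIV. profile_hessian j k x * x $ j)) =
            (\<Sum>k\<in>UNIV. 1 / 4 * c * (?s k * x $ k) - (if k = 3 then 1 / 4 * v ^ 3 * r\<^sup>2 * ?s 3 else 0))"
          unfolding sum_hessian_radial v x c_def A_def
          by (intro sum.cong) (auto simp: algebra_simps)
        also have "\<dots> = 1 / 4 * c * (1 / 4 * S (x $ 3)) - 1 / 4 * v ^ 3 * r\<^sup>2 * ?s 3"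
          by (simp only: sum_subtractf sum_distrib_left[symmetric] slope) simp
        finally show ?thesis
          unfolding c_def[symmetric] by (simp add: profile_slope_def v A_def algebra_simps)
      qed
      \<comment> \<open>The terms with \<open>v ^ 4\<close> and \<open>v ^ 5\<close> enter the
        radial Hessian and the Laplacian alike and drop out of the difference.\<close>
      have num: "(\<Sum>k\<in>UNIV. ?s k * (\<Sum>j\<in>UNIV. profile_hessian j k x * x $ j))
          - (\<Sum>j\<in>UNIV. ?s j * x $ j) * (\<Sum>k\<in>UNIV. profile_hessian k k x) = 1 / 16 * T (x $ 3)"
        unfolding slope lap hess T_def by algebra
      have flux: "energy_flux ?g x = 1 / (16 * r) * T (x $ 3)"
        unfolding profile.energy_flux_graph partial_deriv_profile partial_deriv_profile_slope x num
        by simp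
      \<comment> \<open>The contributions \<open>(A (x $ 3))\<^sup>2 * r\<^sup>2 * x $ i\<close> of
        the two products cancel.\<close>
      have num': "(\<Sum>k\<in>UNIV. ?s k * ?s k) * x $ i - (\<Sum>k\<in>UNIV. ?s k * x $ k) * ?s i = 1 / 16 *
          ((A (x $ 3) * v * x $ 3 + v\<^sup>2) * x $ i - (if i = 3 then 1 else 0) * v * S (x $ 3))"
        unfolding sum_slope_sq slope v x unfolding profile_slope_def v A_def[symmetric] S_def
        by (simp add: algebra_simps power2_eq_square)
      have "(\<Sum>k\<in>UNIV. metric_deviation ?g x $ k $ i * (x $ k / norm x)
          - metric_deviation ?g x $ k $ k * (x $ i / norm x))
          = ((\<Sum>k\<in>UNIV. ?s k * ?s k) * x $ i - (\<Sum>k\<in>UNIV. ?s k * x $ k) * ?s i) / r"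
        unfolding profile.metric_deviation_graph partial_deriv_profile x
        by (simp add: sum_subtractf sum_negf sum_divide_distrib sum_distrib_left sum_distrib_right
            diff_divide_distrib mult_ac)
      also have "\<dots> = 1 / (16 * r) * ((A (x $ 3) * v * x $ 3 + v\<^sup>2) * x $ i
          - (if i = 3 then 1 else 0) * v * S (x $ 3))"
        unfolding num' by simp
      finally show ?thesis
        unfolding flux h_def by (simp add: algebra_simps)
    qed
    show ?thesis
    proof (cases "i = 3")
      case True
      \<comment> \<open>Only the constant and the quadratic coefficient count. The part
        \<open>- 3 * v ^ 3\<close> of the latter cancels the former, and
        \<open>4 * v ^ 5 * r\<^sup>2\<close> leaves \<open>pi / 3 * (r * v) ^ 5\<close>.\<close>
      have "sphere_integral r ?F = sphere_integral r (\<lambda>x. 1 / (16 * r) * (v ^ 3 * r\<^sup>2)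
          + 1 / (16 * r) * (- 3 * v ^ 4 * r\<^sup>2 - v\<^sup>2 + v\<^sup>2 * (1 - v\<^sup>2 * r\<^sup>2)) * x $ 3
          + 1 / (16 * r) * (4 * v ^ 5 * r\<^sup>2 - 3 * v ^ 3) * x $ 3 ^ 2
          + 1 / (16 * r) * (3 * v ^ 4 * (1 - v\<^sup>2 * r\<^sup>2) + v ^ 6 * r\<^sup>2 + v ^ 4) * x $ 3 ^ 3)"
        by (rule sphere_integral_cong)
          (use r in simp, subst F, assumption,
            simp add: h_def T_def S_def A_def True algebra_simps power_numeral_reduce)
      also have "\<dots> = pi / 3 * (r * v) ^ 5"
        using r unfolding sphere_integral_cubic[OF less_imp_le[OF r]]
        by (simp add: field_simps power_numeral_reduce)
      finally show ?thesis
        by (simp add: True v_def)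
    next
      case False
      then have "sphere_integral r ?F = sphere_integral r (\<lambda>x. h (x $ 3) * x $ i)"
        by (intro sphere_integral_cong) (use r in simp, subst F, assumption, simp)
      then show ?thesis
        using sphere_integral_off_axis[OF False] False by simp
    qed
  qed
  have lim: "((\<lambda>r. 1 / (16 * pi) * (pi / 3 * (r / sqrt (1 + r\<^sup>2)) ^ 5)) \<longlongrightarrow> 1 / 48) at_top"
    by real_asymp
  have ev: "\<forall>\<^sub>F r in at_top. 1 / (16 * pi) * (if i = 3 then pi / 3 * (r / sqrt (1 + r\<^sup>2)) ^ 5 else 0)
      = 1 / (16 * pi) * sphere_integral r ?F"
    using eventually_gt_at_top[of "0::real"] by eventually_elim (simp only: I)
  show "((\<lambda>r. 1 / (16 * pi) * sphere_integral r ?F) \<longlongrightarrow> ((1 / 48) *\<^sub>R axis 3 1 :: real^3) $ i) at_top"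
    by (rule Lim_transform_eventually[OF _ ev]) (use lim in \<open>simp add: axis_def\<close>)
qed

theorem theorem3:
  shows "\<exists>f :: real^3 \<Rightarrow> real.
           smooth f \<and> spacelike_graph f \<and>
           asymptotically_flat (induced_metric f) (second_fundamental_form f) \<and>
           has_ADM_energy (induced_metric f) 0 \<and>
           has_ADM_momentum (induced_metric f) (second_fundamental_form f) 0 \<and>
           (\<exists>C :: real^3. C \<noteq> 0 \<and> has_BORT_center (induced_metric f) C)"
proof (intro exI conjI)
  show "smooth profile" "spacelike_graph profile"
    "asymptotically_flat (induced_metric profile) (second_fundamental_form profile)"
    "has_ADM_energy (induced_metric profile) 0"
    "has_ADM_momentum (induced_metric profile) (second_fundamental_form profile) 0"
    "has_BORT_center (induced_metric profile) ((1 / 48) *\<^sub>R axis 3 1)"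
    by (rule profile.smooth_graph profile.spacelike profile.asymptotically_flat_graph
        profile.ADM_energy_zero profile_momentum_zero profile_center)+
  show "(1 / 48) *\<^sub>R axis 3 1 \<noteq> (0 :: real^3)"
    by (simp add: axis_eq_0_iff)
qed

end
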